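(* Let $x$ be an abstract vector variable and $Y=\{y_1,\dots,y_N\}$ a finite set of further abstract vector variables. Let $\varnothing\ne J\subseteq\{1,\dots,N\}$ and $p=|J|$. In degree $k=0$, the exact-support quotient $\operatorname{gr}^JH^Y_0$ is one-dimensional (free of rank one over $\mathbb T_Y$) and $$D^Y_{0,J}=[m-p]_q+p .$$ For $J=\varnothing$, $D^Y_{0,\varnothing}=[m]_q$.
   Context: **Radial algebra.** For a set $S$ of abstract vector variables, $R(S)$ is the associative unital $\mathbb R$-algebra generated by $S$ subject to $[\{u,v\},w]=0$ for all $u,v,w\in S$, where $\{a,b\}=ab+ba$, $[a,b]=ab-ba$. The wedge is the antisymmetrized product $u_1\wedge\cdots\wedge u_p=\frac1{p!}\sum_{\pi}\operatorname{sgn}(\pi)u_{\pi(1)}\cdots u_{\pi(p)}$ (empty wedge $=1$). **Coefficients.** $q,Q$ are algebraically independent indeterminates, $\mathbb B=\mathbb R[q,q^{-1},Q,(1-q)^{-1}]$, $R_{\mathbb B}(S)=\mathbb B\otimes_{\mathbb R}R(S)$. For integers $n,a$: $[n]_q=\frac{1-q^n}{1-q}$, $q^{m+a}:=Qq^a$, $[m+a]_q:=\frac{1-Qq^a}{1-q}$ ($m$ is only a formal symbol). **Scalars.** $r=x^2$, $s_i=\{x,y_i\}$, $c_{ij}=\{y_i,y_j\}=c_{ji}$ are central and $\mathcal A_x(Y)=\mathbb B[r,s_1,\dots,s_N,c_{ij}:1\le i\le j\le N]$ is a polynomial algebra. For $I=\{i_1<\cdots<i_p\}\subset\{1,\dots,N\}$,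 $y_I=y_{i_1}\wedge\cdots\wedge y_{i_p}$, $y_\varnothing=1$. It is known that $R_{\mathbb B}(\{x\}\cup Y)=\bigoplus_I y_I\mathcal A_x(Y)\oplus\bigoplus_I(x\wedge y_I)\mathcal A_x(Y)$, free over $\mathcal A_x(Y)$ on the elements $y_I,\ x\wedge y_I$. **Jackson operators.** For a scalar variable $u$ and parameter $P$: $\delta^{(u)}_Pf=\frac{f(u)-f(Pu)}{(1-P)u}$, $T^{(u)}_Pf(u)=f(Pu)$. For $A\in\mathcal A_x(Y)$, $$\partial^{\mathrm{sc},Y}_{x,q}A=(1+q)\,x\,\delta^{(r)}_{q^2}A+2\sum_{i=1}^N y_i\,T^{(r)}_{q^2}\delta^{(s_i)}_qA.$$ **Finite relative right $q$-vector derivative.** $\partial^{Y,\mathrm R}_{x,q}$ is the $\mathbb B$-linear operator on $R_{\mathbb B}(\{x\}\cup Y)$ with, for $p=|I|$ and $A,B\in\mathcal A_x(Y)$, $$\partial^{Y,\mathrm R}_{x,q}(y_IA)=y_I\,\partial^{\mathrm{sc},Y}_{x,q}(A),\qquad \partial^{Y,\mathrm R}_{x,q}((x\wedge y_I)B)=(-1)^p[m-p]_q\,y_IB+q^{m-p}(x\wedge y_I)\,\partial^{\mathrm{sc},Y}_{x,q}(B).$$ **Homogeneous blocks.** The $x$-degree is $\deg_xr=2$, $\deg_xs_i=1$, $\deg_xc_{ij}=0$, $\deg_xy_I=0$, $\deg_x(x\wedge y_I)=1$. $\mathbb T_Y=\mathbb B[c_{ij}:1\le i\le j\le N]$. $H^Y_n$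 is the degree-$n$ component, a finite free $\mathbb T_Y$-module with basis $y_Ir^as^\beta$ ($2a+|\beta|=n$) and $(x\wedge y_I)r^as^\beta$ ($1+2a+|\beta|=n$). With $R_xF=Fx$, $\mathcal K^Y_k:=\partial^{Y,\mathrm R}_{x,q}R_x|_{H^Y_k}:H^Y_k\to H^Y_k$ is $\mathbb T_Y$-linear. **Support filtration.** The $x$-support of a basis monomial $y_Ir^as^\beta$ or $(x\wedge y_I)r^as^\beta$ is $I\cup\{i:\beta_i>0\}$. $\mathcal F^J_k(Y)$ is the $\mathbb T_Y$-span of the degree-$k$ basis monomials with $x$-support contained in $J$; it is preserved by $\mathcal K^Y_k$. The exact-support quotient is $\operatorname{gr}^JH^Y_k=\mathcal F^J_k(Y)/\sum_{J'\subsetneq J}\mathcal F^{J'}_k(Y)$, and $D^Y_{k,J}$ is the determinant of the endomorphism of it induced by $\mathcal K^Y_k$. *)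

theory Defs
  imports
    "HOL-Computational_Algebra.Computational_Algebra"
    "HOL-Combinatorics.Permutations"
    "HOL-Library.Poly_Mapping"
    "HOL-Algebra.Module"
    "Jordan_Normal_Form.Determinant"
begin

section \<open>The coefficient ring\<close>

text \<open>
  The ring \<open>\<real>[q, 1/q, Q, 1/(1-q)]\<close> is realised inside the fraction field of \<open>\<real>[q][Q]\<close>
  as the set of fractions whose denominator is \<open>q^i * (1-q)^j\<close>.  In the type \<open>real poly poly\<close>
  the inner indeterminate is \<open>q\<close> and the outer one is \<open>Q\<close>.
\<close>

definition q_poly :: "real poly poly" where
  "q_poly = [:[:0, 1:]:]"

definition Q_poly :: "real poly poly" where
  "Q_poly = [:0, 1:]"

lemma q_poly_nonzero [simp]: "q_poly \<noteq> 0" "1 - q_poly \<noteq> 0" "q_poly \<noteq> 1"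
  by (simp_all add: q_poly_def one_pCons)

typedef coeffs = "{Fract f (q_poly ^ i * (1 - q_poly) ^ j) | f i j. True}"
  morphisms fract_of_coeffs coeffs_of_fract
  by blast

setup_lifting type_definition_coeffs

instantiation coeffs :: idom
begin

lift_definition zero_coeffs :: coeffs is 0
  by (rule exI[of _ 0], rule exI[of _ 0], rule exI[of _ 0]) (simp add: Zero_fract_def)

lift_definition one_coeffs :: coeffs is 1
  by (rule exI[of _ 1], rule exI[of _ 0], rule exI[of _ 0]) (simp add: One_fract_def)

lift_definition plus_coeffs :: "coeffs \<Rightarrow> coeffs \<Rightarrow> coeffs" is "(+)"
proof -
  fix a b :: "real poly poly fract"
  assume "\<exists>f i j. a = Fract f (q_poly ^ i * (1 - q_poly) ^ j) \<and> True"
    and "\<exists>f i j. b = Fract f (q_poly ^ i * (1 - q_poly) ^ j) \<and> True"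
  then obtain f i j g k l where
    ab: "a = Fract f (q_poly ^ i * (1 - q_poly) ^ j)" "b = Fract g (q_poly ^ k * (1 - q_poly) ^ l)"
    by blast
  have "a + b = Fract (f * (q_poly ^ k * (1 - q_poly) ^ l) + g * (q_poly ^ i * (1 - q_poly) ^ j))
      (q_poly ^ (i + k) * (1 - q_poly) ^ (j + l))"
    unfolding ab by (subst add_fract) (simp_all add: power_add ac_simps)
  then show "\<exists>f i j. a + b = Fract f (q_poly ^ i * (1 - q_poly) ^ j) \<and> True" by blast
qed

lift_definition uminus_coeffs :: "coeffs \<Rightarrow> coeffs" is uminus
  using minus_fract by blast

definition minus_coeffs :: "coeffs \<Rightarrow> coeffs \<Rightarrow> coeffs" where
  "minus_coeffs a b = a + - b"

lift_definition times_coeffs :: "coeffs \<Rightarrow> coeffs \<Rightarrow> coeffs" is "(*)"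
proof -
  fix a b :: "real poly poly fract"
  assume "\<exists>f i j. a = Fract f (q_poly ^ i * (1 - q_poly) ^ j) \<and> True"
    and "\<exists>f i j. b = Fract f (q_poly ^ i * (1 - q_poly) ^ j) \<and> True"
  then obtain f i j g k l where
    ab: "a = Fract f (q_poly ^ i * (1 - q_poly) ^ j)" "b = Fract g (q_poly ^ k * (1 - q_poly) ^ l)"
    by blast
  have "a * b = Fract (f * g) (q_poly ^ (i + k) * (1 - q_poly) ^ (j + l))"
    unfolding ab by (simp add: power_add ac_simps)
  then show "\<exists>f i j. a * b = Fract f (q_poly ^ i * (1 - q_poly) ^ j) \<and> True" by blast
qed

instance
  by standard (unfold minus_coeffs_def, (transfer, simp add: algebra_simps)+)

end

lift_definition real_coeff :: "real \<Rightarrow> coeffs" is "\<lambda>c. Fract [:[:c:]:] 1"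
  by (rule exI, rule exI[of _ 0], rule exI[of _ 0]) simp

lift_definition qc :: coeffs is "Fract q_poly 1"
  by (rule exI, rule exI[of _ 0], rule exI[of _ 0]) simp

lift_definition qc_inv :: coeffs is "Fract 1 q_poly"
  by (rule exI, rule exI[of _ 1], rule exI[of _ 0]) simp

lift_definition Qc :: coeffs is "Fract Q_poly 1"
  by (rule exI, rule exI[of _ 0], rule exI[of _ 0]) simp

lift_definition one_minus_qc_inv :: coeffs is "Fract 1 (1 - q_poly)"
  by (rule exI, rule exI[of _ 0], rule exI[of _ 1]) simp

definition qc_powi :: "int \<Rightarrow> coeffs" where
  "qc_powi a = (if a \<ge> 0 then qc ^ nat a else qc_inv ^ nat (- a))"

text \<open>\<open>q_m_pow a\<close> is \<open>q^(m+a) = Q q^a\<close> and \<open>q_m_num a\<close> is the \<open>q\<close>-number \<open>[m+a]\<close>;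
  \<open>m\<close> itself is only a formal symbol.\<close>

definition q_m_pow :: "int \<Rightarrow> coeffs" where
  "q_m_pow a = Qc * qc_powi a"

definition q_m_num :: "int \<Rightarrow> coeffs" where
  "q_m_num a = (1 - q_m_pow a) * one_minus_qc_inv"


section \<open>The radial algebra\<close>

text \<open>Words form the free monoid, written additively so that \<open>\<Rightarrow>\<^sub>0\<close> gives its monoid algebra,
  i.e. the free associative algebra.\<close>

datatype 's word = Word (letters: "'s list")

instantiation word :: (type) monoid_add
begin

definition zero_word :: "'s word" where
  "zero_word = Word []"

definition plus_word :: "'s word \<Rightarrow> 's word \<Rightarrow> 's word" where
  "plus_word u v = Word (letters u @ letters v)"

instance
  by standard (simp_all add: zero_word_def plus_word_def)

end

definition free_gen :: "'s \<Rightarrow> 's word \<Rightarrow>\<^sub>0 'b::comm_ring_1" where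
  "free_gen u = Poly_Mapping.single (Word [u]) 1"

definition commutator :: "'a::ring_1 \<Rightarrow> 'a \<Rightarrow> 'a" where
  "commutator a b = a * b - b * a"

definition anticommutator :: "'a::ring_1 \<Rightarrow> 'a \<Rightarrow> 'a" where
  "anticommutator a b = a * b + b * a"

text \<open>The two-sided ideal generated by the elements \<open>[{u,v},w]\<close>.\<close>

inductive_set radial_ideal :: "('s word \<Rightarrow>\<^sub>0 'b::comm_ring_1) set" where
  zero: "0 \<in> radial_ideal"
| gen: "a * commutator (anticommutator (free_gen u) (free_gen v)) (free_gen w) * b \<in> radial_ideal"
| add: "f \<in> radial_ideal \<Longrightarrow> g \<in> radial_ideal \<Longrightarrow> f + g \<in> radial_ideal"

lemma radial_ideal_mult:
  assumes "f \<in> radial_ideal"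
  shows "a * f * b \<in> radial_ideal"
  using assms
proof induction
  case zero
  show ?case by (simp add: radial_ideal.zero)
next
  case (gen a' u v w b')
  show ?case
    using radial_ideal.gen[of "a * a'" u v w "b' * b"] by (simp add: mult.assoc)
next
  case (add f g)
  then show ?case by (simp add: distrib_left distrib_right radial_ideal.add)
qed

lemma radial_ideal_uminus: "f \<in> radial_ideal \<Longrightarrow> - f \<in> radial_ideal"
  using radial_ideal_mult[of f "- 1" 1] by simp

definition radial_rel :: "('s word \<Rightarrow>\<^sub>0 'b::comm_ring_1) \<Rightarrow> ('s word \<Rightarrow>\<^sub>0 'b) \<Rightarrow> bool" where
  "radial_rel f g \<longleftrightarrow> f - g \<in> radial_ideal"

lemma radial_ideal_diff_trans:
  assumes "f - g \<in> radial_ideal" "g - h \<in> radial_ideal"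
  shows "f - h \<in> radial_ideal"
  using radial_ideal.add[OF assms] by simp

lemma equivp_radial_rel: "equivp radial_rel"
proof (rule equivpI)
  show "reflp radial_rel"
    by (rule reflpI) (simp add: radial_rel_def radial_ideal.zero)
  show "symp radial_rel"
    by (rule sympI) (use radial_ideal_uminus in \<open>fastforce simp: radial_rel_def\<close>)
  show "transp radial_rel"
    by (rule transpI) (use radial_ideal_diff_trans in \<open>fastforce simp: radial_rel_def\<close>)
qed

text \<open>\<open>('s, 'b) radial\<close> is the radial algebra over the coefficient ring \<open>'b\<close> whose set of
  vector variables is the whole type \<open>'s\<close>.  Since scalar extension commutes with presentations,
  \<open>('s, coeffs) radial\<close> is the extension of scalars from \<open>\<real>\<close> to \<open>coeffs\<close> of the real radial
  algebra.\<close>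

quotient_type (overloaded) ('s, 'b) radial = "'s word \<Rightarrow>\<^sub>0 'b::comm_ring_1" / radial_rel
  by (rule equivp_radial_rel)

instantiation radial :: (type, comm_ring_1) ring
begin

lift_definition zero_radial :: "('s, 'b::comm_ring_1) radial" is 0 .

lift_definition plus_radial :: "('s, 'b::comm_ring_1) radial \<Rightarrow> ('s, 'b) radial \<Rightarrow> ('s, 'b) radial"
  is "(+)"
  unfolding radial_rel_def by (subst add_diff_add) (rule radial_ideal.add)

lift_definition uminus_radial :: "('s, 'b::comm_ring_1) radial \<Rightarrow> ('s, 'b) radial"
  is uminus
  unfolding radial_rel_def by (subst minus_diff_minus) (rule radial_ideal_uminus)

definition minus_radial :: "('s, 'b::comm_ring_1) radial \<Rightarrow> ('s, 'b) radial \<Rightarrow> ('s, 'b) radial" where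
  "minus_radial f g = f + - g"

lift_definition times_radial :: "('s, 'b::comm_ring_1) radial \<Rightarrow> ('s, 'b) radial \<Rightarrow> ('s, 'b) radial"
  is "(*)"
proof -
  fix a a' b b' :: "'s word \<Rightarrow>\<^sub>0 'b"
  assume "radial_rel a a'" "radial_rel b b'"
  then have "1 * (a - a') * b + a' * (b - b') * 1 \<in> radial_ideal"
    unfolding radial_rel_def by (intro radial_ideal.add radial_ideal_mult)
  then show "radial_rel (a * b) (a' * b')"
    by (simp add: radial_rel_def algebra_simps)
qed

instance
  by standard
    (unfold minus_radial_def,
     (transfer, simp add: radial_rel_def radial_ideal.zero algebra_simps)+)

end

text \<open>The class \<open>ring_1\<close> demands \<open>0 \<noteq> 1\<close>, i.e. that the ideal is proper; this follows since all of
  its elements have vanishing constant term.\<close>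

lemma lookup_times_word_zero:
  fixes f g :: "'s word \<Rightarrow>\<^sub>0 'b::comm_ring_1"
  shows "Poly_Mapping.lookup (f * g) 0 = Poly_Mapping.lookup f 0 * Poly_Mapping.lookup g 0"
proof -
  have word_zero: "0 = u + v \<longleftrightarrow> u = 0 \<and> v = 0" for u v :: "'s word"
    by (cases u; cases v) (auto simp: zero_word_def plus_word_def)
  have "(\<Sum>v. Poly_Mapping.lookup g v when 0 = u + v) = (Poly_Mapping.lookup g 0 when u = 0)" for u
    by (cases "u = 0") (auto simp: word_zero)
  then show ?thesis
    by (simp add: lookup_mult mult_when)
qed

lemma one_notin_radial_ideal: "(1 :: 's word \<Rightarrow>\<^sub>0 'b::comm_ring_1) \<notin> radial_ideal"
proof -
  have "Poly_Mapping.lookup f 0 = 0" if "f \<in> radial_ideal" for f :: "'s word \<Rightarrow>\<^sub>0 'b"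
    using that
    by induction
      (simp_all add: lookup_times_word_zero commutator_def lookup_minus lookup_add ac_simps)
  then show ?thesis
    using lookup_one_zero by fastforce
qed

instantiation radial :: (type, comm_ring_1) ring_1
begin

lift_definition one_radial :: "('s, 'b::comm_ring_1) radial" is 1 .

instance
  by standard
    (transfer, simp add: radial_rel_def radial_ideal.zero,
     transfer, simp add: radial_rel_def radial_ideal.zero,
     transfer, use one_notin_radial_ideal radial_ideal_uminus in \<open>force simp: radial_rel_def\<close>)

end

lift_definition gen :: "'s \<Rightarrow> ('s, 'b::comm_ring_1) radial" is free_gen .

lift_definition scalar :: "'b::comm_ring_1 \<Rightarrow> ('s, 'b) radial" is "Poly_Mapping.single 0" .

definition wedge :: "('s, coeffs) radial list \<Rightarrow> ('s, coeffs) radial" where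
  "wedge us = scalar (real_coeff (1 / fact (length us))) *
     (\<Sum>\<pi> | \<pi> permutes {0..<length us}.
        of_int (sign \<pi>) * prod_list (map (\<lambda>i. us ! \<pi> i) [0..<length us]))"


section \<open>Scalar polynomials and Jackson operators\<close>

text \<open>\<open>Rvar\<close>, \<open>Svar i\<close>, \<open>Cvar i j\<close> (used only for \<open>i \<le> j\<close>) are the indeterminates \<open>r\<close>, \<open>s\<^sub>i\<close>,
  \<open>c\<^sub>i\<^sub>j\<close>.  The type \<open>spoly\<close> has infinitely many of them; for given \<open>N\<close> one works in the
  subrings \<open>scalar_polys N\<close> and \<open>coeff_polys N\<close>.\<close>

datatype svar = Rvar | Svar nat | Cvar nat nat

type_synonym spoly = "(svar \<Rightarrow>\<^sub>0 nat) \<Rightarrow>\<^sub>0 coeffs"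

definition c_vars :: "nat \<Rightarrow> svar list" where
  "c_vars N = [Cvar i j. i \<leftarrow> [1..<N+1], j \<leftarrow> [i..<N+1]]"

definition s_vars :: "nat \<Rightarrow> svar list" where
  "s_vars N = map Svar [1..<N+1]"

definition scalar_vars :: "nat \<Rightarrow> svar list" where
  "scalar_vars N = Rvar # s_vars N @ c_vars N"

definition polys_in :: "svar set \<Rightarrow> spoly set" where
  "polys_in V = {f. \<forall>\<alpha>\<in>Poly_Mapping.keys f. Poly_Mapping.keys \<alpha> \<subseteq> V}"

definition scalar_polys :: "nat \<Rightarrow> spoly set" where
  "scalar_polys N = polys_in (set (scalar_vars N))"

definition coeff_polys :: "nat \<Rightarrow> spoly set" where
  "coeff_polys N = polys_in (set (c_vars N))"

definition pvar :: "svar \<Rightarrow> spoly" where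
  "pvar u = Poly_Mapping.single (Poly_Mapping.single u 1) 1"

definition pconst :: "coeffs \<Rightarrow> spoly" where
  "pconst c = Poly_Mapping.single 0 c"

text \<open>\<open>T f(u) = f(P u)\<close>: the coefficient of a monomial is multiplied by \<open>P\<close> to its \<open>u\<close>-degree.\<close>

definition jackson_shift :: "coeffs \<Rightarrow> svar \<Rightarrow> spoly \<Rightarrow> spoly" where
  "jackson_shift P u f = Poly_Mapping.mapp (\<lambda>\<alpha> c. c * P ^ Poly_Mapping.lookup \<alpha> u) f"

text \<open>The quotient \<open>(f(u) - f(P u)) / ((1 - P) u)\<close>.  It exists because
  \<open>1 - P\<^sup>n\<close> is divisible by \<open>1 - P\<close>, and is unique for \<open>P \<noteq> 1\<close>.\<close>

definition jackson_deriv :: "coeffs \<Rightarrow> svar \<Rightarrow> spoly \<Rightarrow> spoly" where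
  "jackson_deriv P u f = (THE g. pconst (1 - P) * pvar u * g = f - jackson_shift P u f)"

text \<open>From here on \<open>x\<close> is a vector variable and \<open>y 1, \<dots>, y N\<close> are the remaining ones.\<close>

fun svar_value :: "'s \<Rightarrow> (nat \<Rightarrow> 's) \<Rightarrow> svar \<Rightarrow> ('s, coeffs) radial" where
  "svar_value x y Rvar = gen x ^ 2"
| "svar_value x y (Svar i) = anticommutator (gen x) (gen (y i))"
| "svar_value x y (Cvar i j) = anticommutator (gen (y i)) (gen (y j))"

text \<open>Evaluation of scalar polynomials in the radial algebra.  The order of the factors is
  immaterial because the values of the variables are central.\<close>

definition eval_spoly :: "'s \<Rightarrow> (nat \<Rightarrow> 's) \<Rightarrow> nat \<Rightarrow> spoly \<Rightarrow> ('s, coeffs) radial" where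
  "eval_spoly x y N f = (\<Sum>\<alpha>\<in>Poly_Mapping.keys f. scalar (Poly_Mapping.lookup f \<alpha>) *
     prod_list (map (\<lambda>u. svar_value x y u ^ Poly_Mapping.lookup \<alpha> u) (scalar_vars N)))"


section \<open>The finite relative right \<open>q\<close>-vector derivative\<close>

definition y_wedge :: "(nat \<Rightarrow> 's) \<Rightarrow> nat set \<Rightarrow> ('s, coeffs) radial" where
  "y_wedge y I = wedge (map (\<lambda>i. gen (y i)) (sorted_list_of_set I))"

definition xy_wedge :: "'s \<Rightarrow> (nat \<Rightarrow> 's) \<Rightarrow> nat set \<Rightarrow> ('s, coeffs) radial" where
  "xy_wedge x y I = wedge (gen x # map (\<lambda>i. gen (y i)) (sorted_list_of_set I))"

definition scalar_deriv :: "'s \<Rightarrow> (nat \<Rightarrow> 's) \<Rightarrow> nat \<Rightarrow> spoly \<Rightarrow> ('s, coeffs) radial" where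
  "scalar_deriv x y N A =
     scalar (1 + qc) * gen x * eval_spoly x y N (jackson_deriv (qc ^ 2) Rvar A)
     + 2 * (\<Sum>i = 1..N. gen (y i) *
         eval_spoly x y N (jackson_shift (qc ^ 2) Rvar (jackson_deriv qc (Svar i) A)))"

definition is_right_q_deriv ::
  "'s \<Rightarrow> (nat \<Rightarrow> 's) \<Rightarrow> nat \<Rightarrow> (('s, coeffs) radial \<Rightarrow> ('s, coeffs) radial) \<Rightarrow> bool" where
  "is_right_q_deriv x y N D \<longleftrightarrow>
     (\<forall>F G. D (F + G) = D F + D G) \<and>
     (\<forall>b F. D (scalar b * F) = scalar b * D F) \<and>
     (\<forall>I A. I \<subseteq> {1..N} \<longrightarrow> A \<in> scalar_polys N \<longrightarrow>
        D (y_wedge y I * eval_spoly x y N A) = y_wedge y I * scalar_deriv x y N A) \<and>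
     (\<forall>I B. I \<subseteq> {1..N} \<longrightarrow> B \<in> scalar_polys N \<longrightarrow>
        D (xy_wedge x y I * eval_spoly x y N B) =
          (- 1) ^ card I * scalar (q_m_num (- int (card I))) * y_wedge y I * eval_spoly x y N B
          + scalar (q_m_pow (- int (card I))) * xy_wedge x y I * scalar_deriv x y N B)"

text \<open>When \<open>x\<close> and \<open>y 1, \<dots>, y N\<close> are all the variables, existence and uniqueness of this operator
  follow from the radial algebra being free over the scalar polynomials on the elements \<open>y\<^sub>I\<close> and
  \<open>x \<and> y\<^sub>I\<close>.\<close>

definition right_q_deriv ::
  "'s \<Rightarrow> (nat \<Rightarrow> 's) \<Rightarrow> nat \<Rightarrow> ('s, coeffs) radial \<Rightarrow> ('s, coeffs) radial" where
  "right_q_deriv x y N = (THE D. is_right_q_deriv x y N D)"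

definition block_op ::
  "'s \<Rightarrow> (nat \<Rightarrow> 's) \<Rightarrow> nat \<Rightarrow> ('s, coeffs) radial \<Rightarrow> ('s, coeffs) radial" where
  "block_op x y N F = right_q_deriv x y N (F * gen x)"


section \<open>Homogeneous blocks and the support filtration\<close>

text \<open>The index \<open>(e, I, a, \<beta>)\<close> stands for \<open>y\<^sub>I r\<^sup>a s\<^sup>\<beta>\<close> if \<open>e\<close> is false, and for
  \<open>(x \<and> y\<^sub>I) r\<^sup>a s\<^sup>\<beta>\<close> if \<open>e\<close> is true.\<close>

type_synonym mon_index = "bool \<times> nat set \<times> nat \<times> (nat \<Rightarrow> nat)"

definition mon_indices :: "nat \<Rightarrow> mon_index set" where
  "mon_indices N = {(e, I, a, \<beta>). I \<subseteq> {1..N} \<and> {i. \<beta> i > 0} \<subseteq> {1..N}}"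

fun basis_mon :: "'s \<Rightarrow> (nat \<Rightarrow> 's) \<Rightarrow> nat \<Rightarrow> mon_index \<Rightarrow> ('s, coeffs) radial" where
  "basis_mon x y N (e, I, a, \<beta>) =
     (if e then xy_wedge x y I else y_wedge y I) *
     svar_value x y Rvar ^ a * prod_list (map (\<lambda>i. svar_value x y (Svar i) ^ \<beta> i) [1..<N+1])"

fun x_degree :: "nat \<Rightarrow> mon_index \<Rightarrow> nat" where
  "x_degree N (e, I, a, \<beta>) = (if e then 1 else 0) + 2 * a + (\<Sum>i = 1..N. \<beta> i)"

fun x_support :: "mon_index \<Rightarrow> nat set" where
  "x_support (e, I, a, \<beta>) = I \<union> {i. \<beta> i > 0}"

definition coeff_span ::
  "'s \<Rightarrow> (nat \<Rightarrow> 's) \<Rightarrow> nat \<Rightarrow> ('s, coeffs) radial set \<Rightarrow> ('s, coeffs) radial set" where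
  "coeff_span x y N S =
     {\<Sum>b\<in>B. eval_spoly x y N (t b) * b | B t. finite B \<and> B \<subseteq> S \<and> t ` B \<subseteq> coeff_polys N}"

definition supp_filtration ::
  "'s \<Rightarrow> (nat \<Rightarrow> 's) \<Rightarrow> nat \<Rightarrow> nat \<Rightarrow> nat set \<Rightarrow> ('s, coeffs) radial set" where
  "supp_filtration x y N k J = coeff_span x y N
     (basis_mon x y N ` {\<mu> \<in> mon_indices N. x_degree N \<mu> = k \<and> x_support \<mu> \<subseteq> J})"

definition lower_filtration ::
  "'s \<Rightarrow> (nat \<Rightarrow> 's) \<Rightarrow> nat \<Rightarrow> nat \<Rightarrow> nat set \<Rightarrow> ('s, coeffs) radial set" where
  "lower_filtration x y N k J = coeff_span x y N (\<Union>J' \<in> {J'. J' \<subset> J}. supp_filtration x y N k J')"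

definition coset :: "'a::ring_1 set \<Rightarrow> 'a \<Rightarrow> 'a set" where
  "coset L a = {a + z | z. z \<in> L}"

definition coeff_poly_ring :: "nat \<Rightarrow> spoly ring" where
  "coeff_poly_ring N =
     \<lparr>carrier = coeff_polys N, monoid.mult = (*), one = 1, ring.zero = 0, ring.add = (+)\<rparr>"

text \<open>The exact-support quotient, as a module of cosets.  The multiplicative fields of the module
  record are irrelevant.\<close>

definition gr_module ::
  "'s \<Rightarrow> (nat \<Rightarrow> 's) \<Rightarrow> nat \<Rightarrow> nat \<Rightarrow> nat set \<Rightarrow> (spoly, ('s, coeffs) radial set) module" where
  "gr_module x y N k J =
     (let L = lower_filtration x y N k J in
      \<lparr>carrier = coset L ` supp_filtration x y N k J, monoid.mult = undefined, one = undefined,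
       ring.zero = L, ring.add = (\<lambda>C C'. {a + b | a b. a \<in> C \<and> b \<in> C'}),
       smult = (\<lambda>t C. {eval_spoly x y N t * a + z | a z. a \<in> C \<and> z \<in> L})\<rparr>)"

text \<open>The induced endomorphism.  The union is the single coset of \<open>block_op F\<close>, for any \<open>F \<in> C\<close>, precisely
  because \<open>block_op\<close> respects the filtration.\<close>

definition gr_op ::
  "'s \<Rightarrow> (nat \<Rightarrow> 's) \<Rightarrow> nat \<Rightarrow> nat \<Rightarrow> nat set \<Rightarrow> ('s, coeffs) radial set \<Rightarrow> ('s, coeffs) radial set"
  where
  "gr_op x y N k J C = (\<Union>F\<in>C. coset (lower_filtration x y N k J) (block_op x y N F))"


section \<open>Finite free modules and determinants\<close>

definition is_basis :: "('a, 'c) ring_scheme \<Rightarrow> ('a, 'e, 'd) module_scheme \<Rightarrow> nat \<Rightarrow> (nat \<Rightarrow> 'e) \<Rightarrow> bool"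
  where
  "is_basis R M n b \<longleftrightarrow>
     b ` {..<n} \<subseteq> carrier M \<and>
     (\<forall>v\<in>carrier M. \<exists>!c. c \<in> {..<n} \<rightarrow>\<^sub>E carrier R \<and>
        v = (\<Oplus>\<^bsub>M\<^esub>i\<in>{..<n}. c i \<odot>\<^bsub>M\<^esub> b i))"

definition free_of_rank :: "('a, 'c) ring_scheme \<Rightarrow> ('a, 'e, 'd) module_scheme \<Rightarrow> nat \<Rightarrow> bool" where
  "free_of_rank R M n \<longleftrightarrow> module R M \<and> (\<exists>b. is_basis R M n b)"

text \<open>The determinant of an endomorphism of a finite free module, i.e. of its matrix in any basis.
  \<open>R\<close> is meant to be a subring of the type \<open>'a\<close>, whose operations are used by \<open>det\<close>.\<close>

definition endo_det ::
  "('a::comm_ring_1, 'c) ring_scheme \<Rightarrow> ('a, 'e, 'd) module_scheme \<Rightarrow> ('e \<Rightarrow> 'e) \<Rightarrow> 'a" where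
  "endo_det R M \<phi> = (THE d. \<exists>n b A. is_basis R M n b \<and> A \<in> carrier_mat n n \<and>
     (\<forall>i<n. \<forall>j<n. A $$ (i, j) \<in> carrier R) \<and>
     (\<forall>j<n. \<phi> (b j) = (\<Oplus>\<^bsub>M\<^esub>i\<in>{..<n}. A $$ (i, j) \<odot>\<^bsub>M\<^esub> b i)) \<and> d = det A)"

definition block_det :: "'s \<Rightarrow> (nat \<Rightarrow> 's) \<Rightarrow> nat \<Rightarrow> nat \<Rightarrow> nat set \<Rightarrow> spoly" where
  "block_det x y N k J = endo_det (coeff_poly_ring N) (gr_module x y N k J) (gr_op x y N k J)"

end

theory Submission
  imports Defs
begin

text \<open>
  The radial algebra acts on a Clifford module: functions from sets of indices to scalar
  polynomials, on which the \<open>i\<close>-th variable acts as \<open>a\<^sup>* i + 1/2 \<Sum> j. c i j a j\<close> for creation and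
  annihilation operators \<open>a\<^sup>*\<close> and \<open>a\<close>.  Acting on the vacuum sends a wedge product to the
  corresponding basis vector, while ordered products of the variables span the radial algebra and are
  sent to a unitriangular family.  So the module is the coordinate space of the radial algebra with
  respect to the wedge products; this yields existence and uniqueness of the derivative.

  Right multiplication is, up to parity, the operator \<open>a\<^sup>* i - 1/2 \<Sum> j. c i j a j\<close>.  Hence
  \<open>y\<^sub>I x\<close> equals \<open>(-1)\<^sup>p x \<and> y\<^sub>I\<close>, which contributes \<open>[m - p]\<close>, plus a combination of the \<open>s\<^sub>j\<close>, whose
  derivatives reassemble \<open>y\<^sub>I\<close> through the number operator \<open>\<Sum> j. a\<^sup>* j a j\<close>, contributing \<open>p\<close>.
  The corrections by \<open>c i j\<close> cancel, since annihilation operators anticommute and \<open>c\<close> is symmetric.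
\<close>

section \<open>Scalar polynomials\<close>

text \<open>Both the derivative and the determinant are definite descriptions, so freeness over the
  scalar polynomials and independence of the chosen basis have to be proved. The presentation by
  generators and relations gives no normal form; a concrete representation in which distinct
  elements act differently takes its place. The factor 1/2 splits the anticommutator form
  symmetrically. Any bilinear form whose symmetrization is \<open>gram\<close> would give a
  representation, but antisymmetrized products become basis vectors only for the symmetric
  splitting; an unsymmetric one can instead be made to fit ordered products. The variable x carries
  the smallest index 0, so that wedges with and without x form one family indexed by subsets of
  \<open>{..N}\<close>. The summand p in the answer stays undeformed because multiplying a
  degree-zero element by x produces each s_j only to the first power, where the Jackson derivative
  agrees with the ordinary one. Moreover the operator is diagonal in degree zero, so the determinant
  is read off from a single coordinate.\<close>

lemma update_eq_single_add:
  fixes f :: "'a \<Rightarrow>\<^sub>0 'b::comm_monoid_add"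
  assumes "a \<notin> Poly_Mapping.keys f"
  shows "Poly_Mapping.update a b f = Poly_Mapping.single a b + f"
  by (rule poly_mapping_eqI)
    (use assms in \<open>auto simp: lookup_update lookup_add lookup_single in_keys_iff when_def\<close>)

text \<open>The key of the new monomial need not be fresh, so an additive identity reduces at once
  to its case on single monomials.\<close>

lemma poly_mapping_induct_single [case_names zero single_add]:
  fixes f :: "'a \<Rightarrow>\<^sub>0 'b::comm_monoid_add"
  assumes "P 0" and "\<And>a b f. P f \<Longrightarrow> P (Poly_Mapping.single a b + f)"
  shows "P f"
proof (induction f rule: update_induct)
  case (update f a b)
  then show ?case using assms(2)[of f a b] by (simp add: update_eq_single_add)
qed (fact assms(1))

section \<open>Constants and the invertibility of 2\<close>

lemma real_coeff_add: "real_coeff (a + b) = real_coeff a + real_coeff b"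
  by transfer simp

lemma real_coeff_mult: "real_coeff (a * b) = real_coeff a * real_coeff b"
  by transfer simp

lemma real_coeff_0 [simp]: "real_coeff 0 = 0"
  by transfer (simp add: Zero_fract_def)

lemma real_coeff_1 [simp]: "real_coeff 1 = 1"
  by transfer (simp add: One_fract_def one_pCons)

lemma real_coeff_of_nat: "real_coeff (of_nat n) = of_nat n"
  by (induction n) (simp_all add: real_coeff_add)

lemma qc_neq_1: "qc \<noteq> 1"
proof -
  have "fract_of_coeffs qc \<noteq> fract_of_coeffs 1"
    by (simp add: qc.rep_eq one_coeffs.rep_eq One_fract_def eq_fract)
  then show ?thesis by metis
qed

lemma qc_sq_neq_1: "qc ^ 2 \<noteq> 1"
proof -
  have "fract_of_coeffs (qc ^ 2) \<noteq> fract_of_coeffs 1"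
    by (simp add: power2_eq_square times_coeffs.rep_eq qc.rep_eq one_coeffs.rep_eq One_fract_def
        eq_fract q_poly_def one_pCons)
  then show ?thesis by metis
qed

lemma pconst_0 [simp]: "pconst 0 = 0" and pconst_1 [simp]: "pconst 1 = 1"
  by (simp_all add: pconst_def)

lemma pconst_add: "pconst (a + b) = pconst a + pconst b"
  by (simp add: pconst_def single_add)

lemma pconst_uminus: "pconst (- a) = - pconst a"
  by (simp add: pconst_def single_uminus)

lemma pconst_mult: "pconst (a * b) = pconst a * pconst b"
  by (simp add: pconst_def mult_single)

lemma pconst_of_nat: "pconst (of_nat n) = of_nat n"
  by (simp add: pconst_def)

definition half :: spoly where
  "half = pconst (real_coeff (1 / 2))"

lemma half_add_half: "half + half = 1"
  by (simp add: half_def flip: pconst_add real_coeff_add)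

lemma spoly_eq_0_if_double:
  fixes f :: spoly
  assumes "f + f = 0"
  shows "f = 0"
proof -
  have "f = (half + half) * f" by (simp add: half_add_half)
  also have "\<dots> = half * (f + f)" by (simp add: algebra_simps)
  finally show ?thesis using assms by simp
qed

subsection \<open>Jackson derivatives\<close>

lemma lookup_pconst_mult: "Poly_Mapping.lookup (pconst c * f) \<alpha> = c * Poly_Mapping.lookup f \<alpha>"
  by (induction f rule: poly_mapping_induct_single)
    (auto simp: pconst_def distrib_left mult_single lookup_add lookup_single when_def)

lemma lookup_pvar_mult:
  "Poly_Mapping.lookup (pvar u * f) (Poly_Mapping.single u 1 + \<alpha>) = Poly_Mapping.lookup f \<alpha>"
  by (induction f rule: poly_mapping_induct_single)
    (auto simp: pvar_def distrib_left mult_single lookup_add lookup_single when_def)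

lemma jackson_shift_add: "jackson_shift P u (f + g) = jackson_shift P u f + jackson_shift P u g"
  by (rule poly_mapping_eqI)
    (auto simp: jackson_shift_def lookup_mapp lookup_add when_def in_keys_iff simp flip: distrib_right)

lemma jackson_shift_0 [simp]: "jackson_shift P u 0 = 0"
  by (rule poly_mapping_eqI) (simp add: jackson_shift_def lookup_mapp)

lemma jackson_shift_single:
  "jackson_shift P u (Poly_Mapping.single \<alpha> c) =
     Poly_Mapping.single \<alpha> (c * P ^ Poly_Mapping.lookup \<alpha> u)"
  by (rule poly_mapping_eqI)
    (auto simp: jackson_shift_def lookup_mapp lookup_single when_def in_keys_iff)

lemma jackson_shift_mult: "jackson_shift P u (f * g) = jackson_shift P u f * jackson_shift P u g"
proof (induction f rule: poly_mapping_induct_single)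
  case (single_add a b f)
  have "jackson_shift P u (Poly_Mapping.single a b * g) =
      jackson_shift P u (Poly_Mapping.single a b) * jackson_shift P u g"
    by (induction g rule: poly_mapping_induct_single)
      (simp_all add: distrib_left jackson_shift_add jackson_shift_single mult_single lookup_add
        power_add ac_simps)
  then show ?case by (simp add: distrib_right jackson_shift_add single_add)
qed simp

text \<open>The factor \<open>pconst (1 - P) * pvar u\<close> is cancelled coefficientwise:
  multiplication by \<open>pvar u\<close> shifts monomials injectively, and the coefficients form an
  integral domain in which \<open>1 - P\<close> is nonzero.\<close>

lemma jackson_deriv_eqI:
  assumes "P \<noteq> 1" and g: "pconst (1 - P) * pvar u * g = f - jackson_shift P u f"
  shows "jackson_deriv P u f = g"
  unfolding jackson_deriv_def
proof (rule the_equality)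
  fix h assume "pconst (1 - P) * pvar u * h = f - jackson_shift P u f"
  then have eq: "pconst (1 - P) * (pvar u * h) = pconst (1 - P) * (pvar u * g)"
    using g by (simp add: mult.assoc)
  show "h = g"
  proof (rule poly_mapping_eqI)
    fix \<alpha>
    show "Poly_Mapping.lookup h \<alpha> = Poly_Mapping.lookup g \<alpha>"
      using arg_cong[OF eq, of "\<lambda>f. Poly_Mapping.lookup f (Poly_Mapping.single u 1 + \<alpha>)"] assms(1)
      unfolding lookup_pconst_mult lookup_pvar_mult by simp
  qed
qed (fact g)

lemma jackson_deriv_exists: "\<exists>g. pconst (1 - P) * pvar u * g = f - jackson_shift P u f"
proof (induction f rule: poly_mapping_induct_single)
  case zero
  show ?case by (rule exI[of _ 0]) simp
next
  case (single_add a b f)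
  then obtain g where g: "pconst (1 - P) * pvar u * g = f - jackson_shift P u f" by blast
  have "\<exists>h. pconst (1 - P) * pvar u * h =
      Poly_Mapping.single a b - jackson_shift P u (Poly_Mapping.single a b)"
  proof (cases "Poly_Mapping.lookup a u")
    case 0
    then show ?thesis by (intro exI[of _ 0]) (simp add: jackson_shift_single)
  next
    case (Suc n)
    \<comment> \<open>Dividing the monomial by u lowers its u-exponent from \<open>Suc n\<close> to
      n, and (1 - P^(n+1)) / (1 - P) is the geometric sum.\<close>
    define a' where "a' = a - Poly_Mapping.single u 1"
    have a: "a = Poly_Mapping.single u 1 + a'"
      by (rule poly_mapping_eqI)
        (use Suc in \<open>auto simp: a'_def lookup_add lookup_minus lookup_single when_def\<close>)
    have "pconst (1 - P) * pvar u * Poly_Mapping.single a' (b * (\<Sum>i<Suc n. P ^ i)) =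
        Poly_Mapping.single a (b * ((1 - P) * (\<Sum>i<Suc n. P ^ i)))"
      by (simp add: pconst_def pvar_def mult_single a ac_simps)
    also have "\<dots> = Poly_Mapping.single a (b - b * P ^ Suc n)"
      unfolding one_diff_power_eq[symmetric] by (simp add: right_diff_distrib)
    finally show ?thesis
      by (intro exI) (simp add: jackson_shift_single Suc single_diff)
  qed
  then obtain h where "pconst (1 - P) * pvar u * h =
      Poly_Mapping.single a b - jackson_shift P u (Poly_Mapping.single a b)" by blast
  with g have "pconst (1 - P) * pvar u * (h + g) =
      Poly_Mapping.single a b + f - jackson_shift P u (Poly_Mapping.single a b + f)"
    by (simp add: distrib_left jackson_shift_add)
  then show ?case by blast
qed

lemma jackson_deriv_spec:
  assumes "P \<noteq> 1"
  shows "pconst (1 - P) * pvar u * jackson_deriv P u f = f - jackson_shift P u f"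
  using jackson_deriv_exists[of P u f] jackson_deriv_eqI[OF assms] by auto

lemma jackson_deriv_add:
  assumes "P \<noteq> 1"
  shows "jackson_deriv P u (f + g) = jackson_deriv P u f + jackson_deriv P u g"
  by (rule jackson_deriv_eqI[OF assms])
    (simp add: distrib_left jackson_deriv_spec[OF assms] jackson_shift_add)

lemma jackson_deriv_mult_const:
  assumes "P \<noteq> 1" and "jackson_shift P u c = c"
  shows "jackson_deriv P u (f * c) = jackson_deriv P u f * c"
proof (rule jackson_deriv_eqI[OF assms(1)])
  have "pconst (1 - P) * pvar u * (jackson_deriv P u f * c) =
      (pconst (1 - P) * pvar u * jackson_deriv P u f) * c" by (simp add: mult.assoc)
  then show "pconst (1 - P) * pvar u * (jackson_deriv P u f * c) = f * c - jackson_shift P u (f * c)"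
    by (simp add: jackson_deriv_spec[OF assms(1)] jackson_shift_mult assms(2) left_diff_distrib)
qed

lemma jackson_shift_free:
  assumes "f \<in> polys_in V" "u \<notin> V"
  shows "jackson_shift P u f = f"
proof (rule poly_mapping_eqI)
  fix \<alpha>
  have "Poly_Mapping.lookup \<alpha> u = 0" if "\<alpha> \<in> Poly_Mapping.keys f"
    using assms that unfolding polys_in_def by (metis (mono_tags, lifting) in_keys_iff mem_Collect_eq subsetD)
  then show "Poly_Mapping.lookup (jackson_shift P u f) \<alpha> = Poly_Mapping.lookup f \<alpha>"
    by (auto simp: jackson_shift_def lookup_mapp in_keys_iff when_def)
qed

lemma jackson_deriv_free:
  assumes "P \<noteq> 1" "f \<in> polys_in V" "u \<notin> V"
  shows "jackson_deriv P u f = 0"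
  by (rule jackson_deriv_eqI[OF assms(1)]) (simp add: jackson_shift_free[OF assms(2,3)])

lemma jackson_deriv_pvar:
  assumes "P \<noteq> 1"
  shows "jackson_deriv P u (pvar u) = 1"
proof (rule jackson_deriv_eqI[OF assms])
  have "pvar u - jackson_shift P u (pvar u) = Poly_Mapping.single (Poly_Mapping.single u 1) (1 - P)"
    by (simp add: pvar_def jackson_shift_single single_diff)
  then show "pconst (1 - P) * pvar u * 1 = pvar u - jackson_shift P u (pvar u)"
    by (simp add: pconst_def pvar_def mult_single)
qed

subsection \<open>Polynomials in a set of variables\<close>

lemma polys_in_0 [simp]: "0 \<in> polys_in V"
  by (simp add: polys_in_def)

lemma polys_in_pconst [simp]: "pconst c \<in> polys_in V"
  by (cases "c = 0") (auto simp: polys_in_def pconst_def)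

lemma polys_in_1 [simp]: "1 \<in> polys_in V"
  using polys_in_pconst[of 1] by simp

lemma polys_in_numeral [simp]: "numeral n \<in> polys_in V"
  using polys_in_pconst[of "numeral n"] by (simp add: pconst_def)

lemma polys_in_pvar: "u \<in> V \<Longrightarrow> pvar u \<in> polys_in V"
  by (auto simp: polys_in_def pvar_def)

lemma polys_in_add: "f \<in> polys_in V \<Longrightarrow> g \<in> polys_in V \<Longrightarrow> f + g \<in> polys_in V"
  unfolding polys_in_def using keys_add[of f g] by blast

lemma polys_in_uminus: "f \<in> polys_in V \<Longrightarrow> - f \<in> polys_in V"
  by (simp add: polys_in_def in_keys_iff)

lemma polys_in_mult:
  assumes "f \<in> polys_in V" "g \<in> polys_in V"
  shows "f * g \<in> polys_in V"
  unfolding polys_in_def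
proof safe
  fix \<gamma> u assume "\<gamma> \<in> Poly_Mapping.keys (f * g)" and u: "u \<in> Poly_Mapping.keys \<gamma>"
  then obtain \<alpha> \<beta> where "\<gamma> = \<alpha> + \<beta>" "\<alpha> \<in> Poly_Mapping.keys f" "\<beta> \<in> Poly_Mapping.keys g"
    using keys_mult[of f g] by blast
  then show "u \<in> V"
    using assms u keys_add[of \<alpha> \<beta>] unfolding polys_in_def by blast
qed

lemma polys_in_sum: "(\<And>i. i \<in> I \<Longrightarrow> f i \<in> polys_in V) \<Longrightarrow> sum f I \<in> polys_in V"
  by (induction I rule: infinite_finite_induct) (auto intro: polys_in_add)

lemma polys_in_mono: "V \<subseteq> W \<Longrightarrow> polys_in V \<subseteq> polys_in W"
  by (auto simp: polys_in_def)

lemma polys_in_induct [consumes 1, case_names zero monomial_add]: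
  assumes "f \<in> polys_in V" and "P 0"
    and "\<And>\<alpha> c f. Poly_Mapping.keys \<alpha> \<subseteq> V \<Longrightarrow> P f \<Longrightarrow> P (Poly_Mapping.single \<alpha> c + f)"
  shows "P f"
  using assms(1)
proof (induction f rule: update_induct)
  case const
  show ?case by (fact assms(2))
next
  case (update f a b)
  have "Poly_Mapping.keys a \<subseteq> V" "f \<in> polys_in V"
    using update by (auto simp: polys_in_def keys_update)
  then show ?case using assms(3) update by (simp add: update_eq_single_add)
qed

section \<open>Central elements of the radial algebra\<close>

lemma scalar_add: "scalar (a + b) = scalar a + scalar b"
  by transfer (simp add: single_add radial_rel_def radial_ideal.zero)

lemma scalar_mult: "scalar (a * b) = scalar a * scalar b"
  by transfer (simp add: mult_single radial_rel_def radial_ideal.zero)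

lemma scalar_0 [simp]: "scalar 0 = 0"
  by transfer (simp add: radial_rel_def radial_ideal.zero)

lemma scalar_1 [simp]: "scalar 1 = 1"
  by transfer (simp add: radial_rel_def radial_ideal.zero)

lemma scalar_uminus: "scalar (- a) = - scalar a"
  using scalar_add[of a "- a"] by (simp add: eq_neg_iff_add_eq_0 add.commute)

lemma scalar_commute: "F * scalar c = scalar c * F"
proof transfer
  fix F :: "'a word \<Rightarrow>\<^sub>0 'b" and c
  have "F * Poly_Mapping.single 0 c = Poly_Mapping.single 0 c * F"
    by (induction F rule: poly_mapping_induct_single)
      (simp_all add: distrib_left distrib_right mult_single mult.commute)
  then show "radial_rel (F * Poly_Mapping.single 0 c) (Poly_Mapping.single 0 c * F)"
    by (simp add: radial_rel_def radial_ideal.zero)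
qed

text \<open>Words grow by one letter on the left, so statements about the quotient can be proved
  without touching representatives again.\<close>

lemma radial_induct [case_names scalar add gen_mult]:
  fixes F :: "('s, 'b::comm_ring_1) radial"
  assumes scalar: "\<And>c. P (scalar c)"
    and add: "\<And>F G. P F \<Longrightarrow> P G \<Longrightarrow> P (F + G)"
    and gen: "\<And>s F. P F \<Longrightarrow> P (gen s * F)"
  shows "P F"
proof -
  have "P (abs_radial f)" for f
  proof (induction f rule: poly_mapping_induct_single)
    case zero
    show ?case using scalar[of 0] by (simp add: zero_radial.abs_eq)
  next
    case (single_add w c f)
    obtain ws where w: "w = Word ws" by (cases w)
    have "P (abs_radial (Poly_Mapping.single (Word ws) c))"
    proof (induction ws)
      case Nil
      then show ?case using scalar[of c] by (simp add: scalar.abs_eq zero_word_def)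
    next
      case (Cons s ws)
      have "gen s * abs_radial (Poly_Mapping.single (Word ws) c) =
          abs_radial (Poly_Mapping.single (Word (s # ws)) c)"
        by (simp add: gen.abs_eq times_radial.abs_eq free_gen_def mult_single plus_word_def)
      then show ?case using gen[OF Cons, of s] by simp
    qed
    from add[OF this single_add] show ?case
      by (simp add: w plus_radial.abs_eq)
  qed
  then show ?thesis using Quotient_abs_rep[OF Quotient_radial, of F] by metis
qed

definition central :: "'a::ring_1 \<Rightarrow> bool" where
  "central z \<longleftrightarrow> (\<forall>F. F * z = z * F)"

lemma centralD: "central z \<Longrightarrow> F * z = z * F"
  by (simp add: central_def)

lemma central_1 [simp]: "central 1" and central_0 [simp]: "central 0"
  by (simp_all add: central_def)

lemma central_add: "central a \<Longrightarrow> central b \<Longrightarrow> central (a + b)"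
  by (simp add: central_def distrib_left distrib_right)

lemma central_mult:
  assumes a: "central a" and b: "central b"
  shows "central (a * b)"
proof -
  have "F * (a * b) = a * b * F" for F
  proof -
    have "F * (a * b) = a * F * b" using centralD[OF a, of F] by (simp flip: mult.assoc)
    also have "\<dots> = a * b * F" using centralD[OF b, of F] by (simp add: mult.assoc)
    finally show ?thesis .
  qed
  then show ?thesis by (simp add: central_def)
qed

lemma central_power: "central a \<Longrightarrow> central (a ^ n)"
  by (induction n) (simp_all add: central_mult)

lemma central_prod_list: "(\<And>z. z \<in> set zs \<Longrightarrow> central z) \<Longrightarrow> central (prod_list zs)"
  by (induction zs) (simp_all add: central_mult)

lemma central_sum: "(\<And>i. i \<in> I \<Longrightarrow> central (f i)) \<Longrightarrow> central (sum f I)"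
  by (induction I rule: infinite_finite_induct) (simp_all add: central_add)

lemma central_scalar [simp]: "central (scalar c)"
  by (simp add: central_def scalar_commute)

text \<open>The defining relations give commutation with generators only; induction over products
  extends it to the whole algebra.\<close>

lemma central_anticommutator [simp]:
  "central (anticommutator (gen u) (gen v) :: ('s, 'b::comm_ring_1) radial)"
  unfolding central_def
proof
  let ?c = "anticommutator (gen u) (gen v) :: ('s, 'b) radial"
  fix F :: "('s, 'b) radial"
  have *: "gen w * ?c = ?c * gen w" for w
  proof -
    have "commutator ?c (gen w) = 0"
      unfolding commutator_def anticommutator_def minus_radial_def
      apply transfer
      using radial_ideal.gen[of 1 _ _ _ 1]
      by (simp add: radial_rel_def commutator_def anticommutator_def)
    then show ?thesis by (simp add: commutator_def)
  qed
  show "F * ?c = ?c * F"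
  proof (induction F rule: radial_induct)
    case (gen_mult s F)
    have "gen s * F * ?c = gen s * ?c * F" using gen_mult by (simp add: mult.assoc)
    then show ?case using *[of s] by (simp add: mult.assoc)
  qed (simp_all add: scalar_commute distrib_left distrib_right)
qed

lemma half_scalar: "F = scalar (real_coeff (1/2)) * (F + F)"
proof -
  have "scalar (real_coeff (1/2)) * (F + F) = scalar (real_coeff (1/2) + real_coeff (1/2)) * F"
    by (simp only: scalar_add distrib_left distrib_right)
  also have "real_coeff (1/2) + real_coeff (1/2) = 1"
    by (simp flip: real_coeff_add)
  finally show ?thesis by simp
qed

text \<open>A square is half an anticommutator and therefore central, which makes r = x^2 a
  legitimate scalar.\<close>

lemma gen_square: "gen u * gen u = scalar (real_coeff (1/2)) * anticommutator (gen u) (gen u)"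
  by (subst half_scalar) (simp add: anticommutator_def)

lemma central_svar_value [simp]: "central (svar_value x y u)"
  by (cases u) (auto simp: power2_eq_square gen_square intro: central_mult)

subsection \<open>Evaluation of scalar polynomials\<close>

lemma eval_spoly_0 [simp]: "eval_spoly x y N 0 = 0"
  by (simp add: eval_spoly_def)

lemma eval_spoly_add: "eval_spoly x y N (f + g) = eval_spoly x y N f + eval_spoly x y N g"
  unfolding eval_spoly_def
  by (rule setsum_keys_plus_distrib) (simp_all add: scalar_add distrib_right)

lemma eval_spoly_single:
  "eval_spoly x y N (Poly_Mapping.single \<alpha> c) = scalar c *
     prod_list (map (\<lambda>u. svar_value x y u ^ Poly_Mapping.lookup \<alpha> u) (scalar_vars N))"
  by (cases "c = 0") (simp_all add: eval_spoly_def)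

lemma central_eval_spoly [simp]: "central (eval_spoly x y N f)"
  unfolding eval_spoly_def
  by (intro central_sum central_mult central_prod_list) (auto intro: central_power)

text \<open>Reordering the product moves only values of \<open>f\<close>, so the values of
  \<open>g\<close> may be arbitrary.\<close>

lemma prod_list_map_mult_central:
  assumes "\<And>u. u \<in> set us \<Longrightarrow> central (f u)"
  shows "prod_list (map (\<lambda>u. f u * g u) us) = prod_list (map f us) * prod_list (map g us)"
  using assms
proof (induction us)
  case (Cons a us)
  have "central (prod_list (map f us))"
    using Cons.prems by (intro central_prod_list) auto
  then have "g a * prod_list (map f us) = prod_list (map f us) * g a"
    by (rule centralD)
  then have "g a * (prod_list (map f us) * G) = prod_list (map f us) * (g a * G)" for G
    by (metis mult.assoc)
  then show ?case using Cons by (simp add: mult.assoc)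
qed simp

lemma eval_spoly_mult: "eval_spoly x y N (f * g) = eval_spoly x y N f * eval_spoly x y N g"
proof (induction f rule: poly_mapping_induct_single)
  case (single_add \<alpha> a f)
  have "eval_spoly x y N (Poly_Mapping.single \<alpha> a * g) =
      eval_spoly x y N (Poly_Mapping.single \<alpha> a) * eval_spoly x y N g"
  proof (induction g rule: poly_mapping_induct_single)
    case (single_add \<beta> b g)
    have "eval_spoly x y N (Poly_Mapping.single \<alpha> a * Poly_Mapping.single \<beta> b) =
        eval_spoly x y N (Poly_Mapping.single \<alpha> a) * eval_spoly x y N (Poly_Mapping.single \<beta> b)"
    proof -
      let ?m = "\<lambda>\<alpha>. prod_list (map (\<lambda>u. svar_value x y u ^ Poly_Mapping.lookup \<alpha> u) (scalar_vars N))"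
      have "scalar a * scalar b * (?m \<alpha> * ?m \<beta>) = scalar a * ?m \<alpha> * (scalar b * ?m \<beta>)"
        using scalar_commute[of "?m \<alpha>" b] by (metis (no_types) mult.assoc)
      then show ?thesis
        by (simp add: mult_single eval_spoly_single lookup_add power_add scalar_mult
            prod_list_map_mult_central central_power)
    qed
    then show ?case by (simp add: distrib_left eval_spoly_add single_add)
  qed simp
  then show ?case by (simp add: distrib_right eval_spoly_add single_add)
qed simp

lemma prod_list_map_if_eq:
  fixes f :: "'a \<Rightarrow> 'b::monoid_mult"
  assumes "u \<in> set us" "distinct us"
  shows "prod_list (map (\<lambda>v. if v = u then f v else 1) us) = f u"
  using assms
proof (induction us)
  case (Cons a us)
  have "prod_list (map (\<lambda>v. if v = u then f v else 1) us) = 1" if "u \<notin> set us"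
    using that by (induction us) auto
  with Cons show ?case by auto
qed simp

lemma set_scalar_vars:
  "set (scalar_vars N) = insert Rvar (Svar ` {1..N} \<union> (\<lambda>(i, j). Cvar i j) ` {(i, j). 1 \<le> i \<and> i \<le> j \<and> j \<le> N})"
  by (auto simp: scalar_vars_def s_vars_def c_vars_def image_iff)

lemma distinct_scalar_vars: "distinct (scalar_vars N)"
proof -
  have "distinct (concat (map (\<lambda>i. map (Cvar i) [i..<n]) is))" if "distinct is" for "is" n
    using that by (induction "is") (auto simp: distinct_map inj_on_def)
  then have "distinct (c_vars N)"
    unfolding c_vars_def by (simp only: distinct_upt)
  then show ?thesis
    by (auto simp: scalar_vars_def s_vars_def c_vars_def distinct_map inj_on_def)
qed

lemma eval_spoly_pconst [simp]: "eval_spoly x y N (pconst c) = scalar c"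
proof -
  have "prod_list (map (\<lambda>u. 1) us) = (1::('a, coeffs) radial)" for us :: "svar list"
    by (induction us) auto
  then show ?thesis by (simp add: pconst_def eval_spoly_single)
qed

lemma eval_spoly_1 [simp]: "eval_spoly x y N 1 = 1"
  using eval_spoly_pconst[of x y N 1] by simp

lemma eval_spoly_2 [simp]: "eval_spoly x y N 2 = 2"
  using eval_spoly_add[of x y N 1 1] by simp

lemma eval_spoly_pvar:
  assumes "u \<in> set (scalar_vars N)"
  shows "eval_spoly x y N (pvar u) = svar_value x y u"
proof -
  have "(\<lambda>v. svar_value x y v ^ Poly_Mapping.lookup (Poly_Mapping.single u 1) v) =
      (\<lambda>v. if v = u then svar_value x y v else 1)"
    by (auto simp: lookup_single when_def fun_eq_iff)
  then show ?thesis
    using prod_list_map_if_eq[OF assms distinct_scalar_vars, of "svar_value x y"]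
    by (simp add: pvar_def eval_spoly_single)
qed

section \<open>The Clifford module\<close>

type_synonym cmod = "nat set \<Rightarrow> spoly"

text \<open>The Jordan-Wigner sign: the parity of the number of factors that index i must pass to
  reach its place in the increasing order.\<close>

definition jw_sign :: "nat \<Rightarrow> nat set \<Rightarrow> spoly" where
  "jw_sign i K = (- 1) ^ card {k \<in> K. k < i}"

text \<open>Creation and, below, annihilation in coordinates: the coefficient at K is fetched from
  the set that the operator turns into K, hence \<open>K - {i}\<close> here and
  \<open>insert i K\<close> for \<open>del\<close>.\<close>

definition ins :: "nat \<Rightarrow> cmod \<Rightarrow> cmod" where
  "ins i f K = (if i \<in> K then jw_sign i K * f (K - {i}) else 0)"

definition del :: "nat \<Rightarrow> cmod \<Rightarrow> cmod" where
  "del i f K = (if i \<in> K then 0 else jw_sign i K * f (insert i K))"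

definition vacuum :: cmod where
  "vacuum K = (if K = {} then 1 else 0)"

lemma jw_sign_square: "jw_sign i K * jw_sign i K = 1"
  by (simp add: jw_sign_def flip: power_add mult_2)

lemma jw_sign_square_mult: "jw_sign i K * (jw_sign i K * f) = f"
  by (simp add: jw_sign_square flip: mult.assoc)

lemma jw_sign_empty [simp]: "jw_sign i {} = 1"
  by (simp add: jw_sign_def)

lemma jw_sign_insert_ge [simp]: "i \<le> j \<Longrightarrow> jw_sign i (insert j K) = jw_sign i K"
  unfolding jw_sign_def by (rule arg_cong[of _ _ "\<lambda>S. (- 1) ^ card S"]) auto

lemma jw_sign_insert_less [simp]:
  assumes "j < i" "j \<notin> K"
  shows "jw_sign i (insert j K) = - jw_sign i K"
proof -
  have "{k \<in> insert j K. k < i} = insert j {k \<in> K. k < i}" using assms by auto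
  then show ?thesis using assms by (simp add: jw_sign_def)
qed

lemma jw_sign_diff_ge [simp]: "i \<le> j \<Longrightarrow> jw_sign i (K - {j}) = jw_sign i K"
  unfolding jw_sign_def by (rule arg_cong[of _ _ "\<lambda>S. (- 1) ^ card S"]) auto

lemma jw_sign_diff_less [simp]:
  assumes "j < i" "j \<in> K"
  shows "jw_sign i (K - {j}) = - jw_sign i K"
  using jw_sign_insert_less[of j i "K - {j}"] assms by (simp add: insert_absorb)

text \<open>Only the sign of the larger index counts the smaller one, so exchanging two operators
  flips exactly one of the two signs; this is why the order of i and j is split into cases.\<close>

lemma del_del: "del i (del j f) K = - del j (del i f) K"
proof (cases i j rule: linorder_cases)
  case less
  then show ?thesis by (simp add: del_def insert_commute)
next
  case greater
  then show ?thesis by (simp add: del_def insert_commute)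
qed (simp add: del_def)

lemma insert_Diff_neq: "i \<noteq> j \<Longrightarrow> insert i K - {j} = insert i (K - {j})"
  by auto

lemma ins_ins: "ins i (ins j f) K = - ins j (ins i f) K"
proof (cases i j rule: linorder_cases)
  case less
  then show ?thesis by (simp add: ins_def Diff_insert2[symmetric] insert_commute)
next
  case greater
  then show ?thesis by (simp add: ins_def Diff_insert2[symmetric] insert_commute)
qed (simp add: ins_def)

text \<open>The canonical anticommutation relations. For distinct indices the two orders differ by
  one sign; for equal ones exactly one summand survives, depending on whether i lies in K, and its
  two equal signs cancel.\<close>

lemma del_ins: "del i (ins j f) K + ins j (del i f) K = (if i = j then f K else 0)"
proof (cases i j rule: linorder_cases)
  case less
  then show ?thesis by (auto simp: ins_def del_def insert_Diff_neq)
next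
  case equal
  then show ?thesis
    by (auto simp: ins_def del_def jw_sign_square_mult insert_absorb)
next
  case greater
  then show ?thesis by (auto simp: ins_def del_def insert_Diff_neq)
qed

lemma ins_add: "ins i (\<lambda>K. f K + g K) = (\<lambda>K. ins i f K + ins i g K)"
  by (auto simp: ins_def distrib_left)

lemma del_add: "del i (\<lambda>K. f K + g K) = (\<lambda>K. del i f K + del i g K)"
  by (auto simp: del_def distrib_left)

lemma ins_smult: "ins i (\<lambda>K. c * f K) = (\<lambda>K. c * ins i f K)"
  by (auto simp: ins_def ac_simps)

lemma del_smult: "del i (\<lambda>K. c * f K) = (\<lambda>K. c * del i f K)"
  by (auto simp: del_def ac_simps)

lemma ins_sum: "ins i (\<lambda>K. \<Sum>a\<in>A. f a K) = (\<lambda>K. \<Sum>a\<in>A. ins i (f a) K)"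
  by (auto simp: ins_def sum_distrib_left)

lemma del_sum: "del i (\<lambda>K. \<Sum>a\<in>A. f a K) = (\<lambda>K. \<Sum>a\<in>A. del i (f a) K)"
  by (auto simp: del_def sum_distrib_left)

text \<open>The polynomial standing for \<open>{g i, g j}\<close>, where \<open>g 0 = x\<close> and \<open>g i = y i\<close> for \<open>i > 0\<close>;
  in particular \<open>{x, x} = 2 r\<close>.\<close>

definition gram :: "nat \<Rightarrow> nat \<Rightarrow> spoly" where
  "gram i j = (if i = 0 \<and> j = 0 then 2 * pvar Rvar
     else if i = 0 then pvar (Svar j) else if j = 0 then pvar (Svar i)
     else pvar (Cvar (min i j) (max i j)))"

lemma gram_commute: "gram i j = gram j i"
  by (simp add: gram_def min.commute max.commute)

text \<open>The interior product with the linear form \<open>gram i\<close>.\<close>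

definition contract :: "nat \<Rightarrow> nat \<Rightarrow> cmod \<Rightarrow> cmod" where
  "contract N i f K = (\<Sum>j\<le>N. gram i j * del j f K)"

text \<open>With \<open>t\<close> equal to one half this is left multiplication by the \<open>i\<close>-th generator, and with
  minus one half, up to the parity sign, it is right multiplication.\<close>

definition clifford :: "nat \<Rightarrow> spoly \<Rightarrow> nat \<Rightarrow> cmod \<Rightarrow> cmod" where
  "clifford N t i f K = ins i f K + t * contract N i f K"

lemma contract_add: "contract N i (\<lambda>K. f K + g K) = (\<lambda>K. contract N i f K + contract N i g K)"
  by (simp add: contract_def del_add distrib_left sum.distrib fun_eq_iff)

lemma contract_smult: "contract N i (\<lambda>K. c * f K) = (\<lambda>K. c * contract N i f K)"
  by (simp add: contract_def del_smult sum_distrib_left ac_simps fun_eq_iff)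

lemma clifford_add:
  "clifford N t i (\<lambda>K. f K + g K) = (\<lambda>K. clifford N t i f K + clifford N t i g K)"
  by (simp add: clifford_def contract_add ins_add algebra_simps fun_eq_iff)

lemma clifford_smult: "clifford N t i (\<lambda>K. c * f K) = (\<lambda>K. c * clifford N t i f K)"
  by (simp add: clifford_def contract_smult ins_smult algebra_simps fun_eq_iff)

lemma contract_ins:
  "contract N i (ins k f) K + ins k (contract N i f) K = (if k \<le> N then gram i k * f K else 0)"
proof -
  have "ins k (contract N i f) K = (\<Sum>j\<le>N. gram i j * ins k (del j f) K)"
    unfolding contract_def[abs_def] ins_sum ins_smult ..
  then have "contract N i (ins k f) K + ins k (contract N i f) K =
      (\<Sum>j\<le>N. gram i j * (del j (ins k f) K + ins k (del j f) K))"
    by (simp add: contract_def distrib_left sum.distrib)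
  also have "\<dots> = (\<Sum>j\<le>N. if j = k then gram i j * f K else 0)"
    by (intro sum.cong) (auto simp: del_ins)
  finally show ?thesis by simp
qed

lemma contract_contract: "contract N i (contract N k f) K + contract N k (contract N i f) K = 0"
proof -
  have expand: "contract N i (contract N k f) K =
      (\<Sum>j\<le>N. \<Sum>l\<le>N. gram i j * (gram k l * del j (del l f) K))" for i k
    unfolding contract_def[of N k f, abs_def] contract_def del_sum del_smult
    by (simp add: sum_distrib_left)
  have "contract N k (contract N i f) K =
      (\<Sum>l\<le>N. \<Sum>j\<le>N. gram k j * (gram i l * del j (del l f) K))"
    unfolding expand by (rule sum.swap)
  also have "\<dots> = (\<Sum>l\<le>N. \<Sum>j\<le>N. - (gram i l * (gram k j * del l (del j f) K)))"
    by (intro sum.cong refl) (subst del_del, simp add: ac_simps)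
  also have "\<dots> = - contract N i (contract N k f) K"
    unfolding expand by (simp add: sum_negf)
  finally show ?thesis by simp
qed

text \<open>The two parameters are kept independent because two cases are needed: s = t = 1/2 yields
  the relations of the radial algebra, while opposite halves yield 0 and relate left to right
  multiplication. The conditionals appear because \<open>contract\<close> annihilates only indices
  up to N.\<close>

lemma clifford_anticommute:
  "clifford N s i (clifford N t k f) K + clifford N t k (clifford N s i f) K =
     ((if k \<le> N then s * gram i k else 0) + (if i \<le> N then t * gram k i else 0)) * f K"
proof -
  have eq: "clifford N s i (clifford N t k f) K =
      ins i (ins k f) K + t * ins i (contract N k f) K +
      s * (contract N i (ins k f) K + t * contract N i (contract N k f) K)" for s t i k
    unfolding clifford_def[of N t k f, abs_def]
    unfolding clifford_def contract_add contract_smult ins_add ins_smult by simp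
  have "clifford N s i (clifford N t k f) K + clifford N t k (clifford N s i f) K =
     (ins i (ins k f) K + ins k (ins i f) K) +
     t * (contract N k (ins i f) K + ins i (contract N k f) K) +
     s * (contract N i (ins k f) K + ins k (contract N i f) K) +
     s * t * (contract N i (contract N k f) K + contract N k (contract N i f) K)"
    unfolding eq by (simp add: algebra_simps)
  also have "\<dots> = t * (if i \<le> N then gram k i * f K else 0) + s * (if k \<le> N then gram i k * f K else 0)"
    unfolding contract_ins contract_contract by (simp add: ins_ins[of i k])
  finally show ?thesis by (auto simp: algebra_simps)
qed

section \<open>The action of the radial algebra\<close>

definition word_act :: "nat \<Rightarrow> ('s \<Rightarrow> nat) \<Rightarrow> 's word \<Rightarrow> cmod \<Rightarrow> cmod" where
  "word_act N ix w = foldr (\<lambda>s. clifford N half (ix s)) (letters w)"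

lemma word_act_add:
  "word_act N ix w (\<lambda>K. f K + g K) = (\<lambda>K. word_act N ix w f K + word_act N ix w g K)"
proof -
  have "foldr (\<lambda>s. clifford N half (ix s)) ws (\<lambda>K. f K + g K) =
      (\<lambda>K. foldr (\<lambda>s. clifford N half (ix s)) ws f K + foldr (\<lambda>s. clifford N half (ix s)) ws g K)" for ws
    by (induction ws) (simp_all add: clifford_add)
  then show ?thesis by (simp add: word_act_def)
qed

lemma word_act_smult: "word_act N ix w (\<lambda>K. c * f K) = (\<lambda>K. c * word_act N ix w f K)"
proof -
  have "foldr (\<lambda>s. clifford N half (ix s)) ws (\<lambda>K. c * f K) =
      (\<lambda>K. c * foldr (\<lambda>s. clifford N half (ix s)) ws f K)" for ws
    by (induction ws) (simp_all add: clifford_smult)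
  then show ?thesis by (simp add: word_act_def)
qed

lemma word_act_plus: "word_act N ix (v + w) f = word_act N ix v (word_act N ix w f)"
  by (simp add: word_act_def plus_word_def)

definition free_act :: "nat \<Rightarrow> ('s \<Rightarrow> nat) \<Rightarrow> ('s word \<Rightarrow>\<^sub>0 coeffs) \<Rightarrow> cmod \<Rightarrow> cmod" where
  "free_act N ix F f K =
     (\<Sum>w\<in>Poly_Mapping.keys F. pconst (Poly_Mapping.lookup F w) * word_act N ix w f K)"

lemma free_act_zero [simp]: "free_act N ix 0 f K = 0"
  by (simp add: free_act_def)

lemma free_act_plus: "free_act N ix (F + G) f K = free_act N ix F f K + free_act N ix G f K"
  unfolding free_act_def
  by (rule setsum_keys_plus_distrib) (simp_all add: pconst_add distrib_right)

lemma free_act_uminus: "free_act N ix (- F) f K = - free_act N ix F f K"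
  using free_act_plus[of N ix F "- F" f K] by (simp add: eq_neg_iff_add_eq_0 add.commute)

lemma free_act_minus: "free_act N ix (F - G) f K = free_act N ix F f K - free_act N ix G f K"
  using free_act_plus[of N ix F "- G" f K] by (simp add: free_act_uminus)

lemma free_act_single:
  "free_act N ix (Poly_Mapping.single w c) f K = pconst c * word_act N ix w f K"
  by (cases "c = 0") (simp_all add: free_act_def)

lemma free_act_gen: "free_act N ix (free_gen s) f = clifford N half (ix s) f"
  by (simp add: free_gen_def free_act_single word_act_def fun_eq_iff)

lemma free_act_smult: "free_act N ix F (\<lambda>K. c * f K) = (\<lambda>K. c * free_act N ix F f K)"
  by (simp add: free_act_def word_act_smult sum_distrib_left ac_simps fun_eq_iff)

lemma free_act_times: "free_act N ix (F * G) f K = free_act N ix F (free_act N ix G f) K"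
proof (induction F arbitrary: K rule: poly_mapping_induct_single)
  case (single_add w a F)
  have "free_act N ix (Poly_Mapping.single w a * G) f = (\<lambda>K. pconst a * word_act N ix w (free_act N ix G f) K)"
  proof (induction G rule: poly_mapping_induct_single)
    case zero
    have "word_act N ix w (\<lambda>K. 0) = (\<lambda>K. 0)"
      using word_act_smult[of N ix w 0 "\<lambda>K. 0"] by simp
    then show ?case by (simp add: free_act_def[abs_def])
  next
    case (single_add v b G)
    have "free_act N ix (Poly_Mapping.single v b + G) f =
        (\<lambda>K. pconst b * word_act N ix v f K + free_act N ix G f K)"
      by (simp add: free_act_plus free_act_single fun_eq_iff)
    then show ?case
      unfolding distrib_left
      by (simp add: single_add free_act_plus free_act_single mult_single pconst_mult word_act_plus
          word_act_add word_act_smult algebra_simps fun_eq_iff)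
  qed
  then show ?case
    by (simp add: single_add distrib_right free_act_plus free_act_single)
qed simp

lemma free_act_anticommutator:
  "free_act N ix (anticommutator (free_gen u) (free_gen v)) f K =
     ((if ix v \<le> N then half * gram (ix u) (ix v) else 0) +
      (if ix u \<le> N then half * gram (ix v) (ix u) else 0)) * f K"
  by (simp add: anticommutator_def free_act_plus free_act_times free_act_gen clifford_anticommute)

text \<open>An anticommutator of two generators acts as multiplication by a polynomial
  \<open>z\<close>, and every element acts linearly over the polynomials, so the commutator with a
  third generator acts as zero.\<close>

lemma free_act_radial_ideal:
  assumes "F \<in> radial_ideal"
  shows "free_act N ix F f K = 0"
  using assms
proof (induction arbitrary: K)
  case (gen a u v w b)
  define z where "z = (if ix v \<le> N then half * gram (ix u) (ix v) else 0) +
      (if ix u \<le> N then half * gram (ix v) (ix u) else 0)"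
  let ?g = "free_act N ix b f"
  have anti: "free_act N ix (anticommutator (free_gen u) (free_gen v)) = (\<lambda>f K. z * f K)"
    by (simp add: free_act_anticommutator z_def fun_eq_iff)
  have "free_act N ix (commutator (anticommutator (free_gen u) (free_gen v)) (free_gen w)) ?g = (\<lambda>K. 0 * 0)"
    unfolding commutator_def
    by (simp add: free_act_minus free_act_times[abs_def] anti free_act_smult fun_eq_iff)
  then show ?case
    using free_act_smult[of N ix a 0 "\<lambda>K. 0"] by (simp add: free_act_times[abs_def])
qed (simp_all add: free_act_plus)

lift_definition radial_act :: "nat \<Rightarrow> ('s \<Rightarrow> nat) \<Rightarrow> ('s, coeffs) radial \<Rightarrow> cmod \<Rightarrow> cmod" is free_act
proof -
  fix N and ix :: "'s \<Rightarrow> nat" and F G :: "'s word \<Rightarrow>\<^sub>0 coeffs"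
  assume "radial_rel F G"
  then have "free_act N ix (F - G) f K = 0" for f K
    by (simp add: radial_rel_def free_act_radial_ideal)
  then have "free_act N ix F f K = free_act N ix G f K" for f K
    using free_act_plus[of N ix "F - G" G f K] by simp
  then show "free_act N ix F = free_act N ix G" by (simp add: fun_eq_iff)
qed

lemma radial_act_plus: "radial_act N ix (F + G) f K = radial_act N ix F f K + radial_act N ix G f K"
  by transfer (rule free_act_plus)

lemma radial_act_times: "radial_act N ix (F * G) f K = radial_act N ix F (radial_act N ix G f) K"
  by transfer (rule free_act_times)

lemma radial_act_gen: "radial_act N ix (gen s) f = clifford N half (ix s) f"
  by transfer (rule free_act_gen)

lemma radial_act_scalar: "radial_act N ix (scalar c) f K = pconst c * f K"
  by transfer (simp add: free_act_single word_act_def zero_word_def)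

lemma radial_act_0: "radial_act N ix 0 f K = 0"
  by transfer simp

lemma radial_act_1: "radial_act N ix 1 f K = f K"
  using radial_act_scalar[of N ix 1] by simp

lemma radial_act_uminus: "radial_act N ix (- F) f K = - radial_act N ix F f K"
  using radial_act_plus[of N ix F "- F" f K] by (simp add: radial_act_0 eq_neg_iff_add_eq_0 add.commute)

lemma radial_act_sum: "radial_act N ix (\<Sum>a\<in>A. F a) f K = (\<Sum>a\<in>A. radial_act N ix (F a) f K)"
  by (induction A rule: infinite_finite_induct) (simp_all add: radial_act_plus radial_act_0)

section \<open>Parity and right multiplication\<close>

definition parity :: "nat \<Rightarrow> cmod \<Rightarrow> cmod" where
  "parity N f K = jw_sign (Suc N) K * f K"

text \<open>\<open>jw_sign (Suc N)\<close> counts the elements up to N, so \<open>parity\<close> is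
  the grading involution. It accounts for a generator entering from the right across all factors;
  the contraction then has the opposite sign to that of left multiplication.\<close>

definition right_clifford :: "nat \<Rightarrow> nat \<Rightarrow> cmod \<Rightarrow> cmod" where
  "right_clifford N i f = clifford N (- half) i (parity N f)"

lemma parity_del: "j \<le> N \<Longrightarrow> parity N (del j f) K = - del j (parity N f) K"
  by (auto simp: parity_def del_def)

lemma parity_clifford:
  assumes "i \<le> N"
  shows "parity N (clifford N t i f) K = - clifford N t i (parity N f) K"
proof -
  have ins: "parity N (ins i f) K = - ins i (parity N f) K"
    using assms by (auto simp: parity_def ins_def)
  have "parity N (contract N i f) K = (\<Sum>j\<le>N. gram i j * parity N (del j f) K)"
    by (simp add: parity_def contract_def sum_distrib_left ac_simps)
  also have "\<dots> = - contract N i (parity N f) K"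
    by (simp add: parity_del contract_def sum_negf)
  finally have con: "parity N (contract N i f) K = - contract N i (parity N f) K" .
  have "parity N (clifford N t i f) K = parity N (ins i f) K + t * parity N (contract N i f) K"
    by (simp add: parity_def clifford_def algebra_simps)
  then show ?thesis by (simp add: ins con clifford_def)
qed

text \<open>Parity changes the sign of a Clifford operator, and operators with opposite halves
  anticommute; the two signs cancel. This reflects associativity of the algebra.\<close>

lemma right_clifford_commute:
  assumes "i \<le> N" "k \<le> N"
  shows "right_clifford N i (clifford N half k f) = clifford N half k (right_clifford N i f)"
proof
  fix K
  have "parity N (clifford N half k f) = (\<lambda>K. (- 1) * clifford N half k (parity N f) K)"
    by (simp add: parity_clifford[OF assms(2)] fun_eq_iff)
  then have "right_clifford N i (clifford N half k f) K =
      - clifford N (- half) i (clifford N half k (parity N f)) K"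
    by (simp only: right_clifford_def clifford_smult) simp
  also have "\<dots> = clifford N half k (clifford N (- half) i (parity N f)) K"
    using clifford_anticommute[of N "- half" i half k "parity N f" K] assms
    by (simp add: gram_commute[of i k] neg_eq_iff_add_eq_0)
  finally show "right_clifford N i (clifford N half k f) K = clifford N half k (right_clifford N i f) K"
    by (simp add: right_clifford_def)
qed

lemma right_clifford_add:
  "right_clifford N i (\<lambda>K. f K + g K) = (\<lambda>K. right_clifford N i f K + right_clifford N i g K)"
proof -
  have "parity N (\<lambda>K. f K + g K) = (\<lambda>K. parity N f K + parity N g K)"
    by (simp add: parity_def distrib_left fun_eq_iff)
  then show ?thesis by (simp add: right_clifford_def clifford_add)
qed

lemma right_clifford_smult: "right_clifford N i (\<lambda>K. c * f K) = (\<lambda>K. c * right_clifford N i f K)"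
proof -
  have "parity N (\<lambda>K. c * f K) = (\<lambda>K. c * parity N f K)"
    by (simp add: parity_def ac_simps fun_eq_iff)
  then show ?thesis by (simp add: right_clifford_def clifford_smult)
qed

lemma contract_vacuum: "contract N i vacuum K = 0"
  by (auto simp: contract_def del_def vacuum_def intro!: sum.neutral)

text \<open>Contractions kill the vacuum, so the sign of the half is invisible there.\<close>

lemma right_clifford_vacuum: "right_clifford N i vacuum = clifford N half i vacuum"
proof -
  have "parity N vacuum = vacuum"
    by (simp add: parity_def vacuum_def fun_eq_iff)
  then have "right_clifford N i vacuum = clifford N (- half) i vacuum"
    by (simp add: right_clifford_def)
  then show ?thesis
    by (simp add: clifford_def contract_vacuum fun_eq_iff)
qed

lemma right_clifford_act:
  assumes "\<And>s. ix s \<le> N" "i \<le> N"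
  shows "right_clifford N i (radial_act N ix F f) = radial_act N ix F (right_clifford N i f)"
proof (induction F rule: radial_induct)
  case (scalar c)
  show ?case
    by (simp add: radial_act_scalar[abs_def] right_clifford_smult)
next
  case (add F G)
  then show ?case
    by (simp add: radial_act_plus[abs_def] right_clifford_add fun_eq_iff)
next
  case (gen_mult s F)
  then show ?case
    by (simp add: radial_act_times[abs_def] radial_act_gen right_clifford_commute assms)
qed

section \<open>Antisymmetrised products\<close>

text \<open>The wedge without its factor 1/n! and on indexed families, which makes the recursion on
  the first factor free of denominators.\<close>

definition perm_sum :: "nat \<Rightarrow> (nat \<Rightarrow> 'a::ring_1) \<Rightarrow> 'a" where
  "perm_sum n v = (\<Sum>\<pi> | \<pi> permutes {0..<n}.
     of_int (sign \<pi>) * prod_list (map (\<lambda>i. v (\<pi> i)) [0..<n]))"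

lemma perm_sum_0 [simp]: "perm_sum 0 v = 1"
  by (simp add: perm_sum_def)

text \<open>Expansion along the first factor: permutations are grouped by j = \<pi> 0,
  \<open>permutation_insert 0 j\<close> parametrizes each group, and bringing position j to the
  front costs j transpositions. The remaining factors skip j through
  \<open>insert_index\<close>.\<close>

lemma perm_sum_Suc:
  "perm_sum (Suc n) v = (\<Sum>j<Suc n. (- 1) ^ j * (v j * perm_sum n (\<lambda>i. v (insert_index j i))))"
proof -
  let ?S = "{0..<Suc n}"
  let ?t = "\<lambda>\<pi>. of_int (sign \<pi>) * prod_list (map (\<lambda>i. v (\<pi> i)) [0..<Suc n])"
  have "{\<pi>. \<pi> permutes ?S} = (\<Union>j\<in>?S. {\<pi>. \<pi> permutes ?S \<and> \<pi> 0 = j})"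
    using permutes_in_image by fastforce
  then have "perm_sum (Suc n) v = sum ?t (\<Union>j\<in>?S. {\<pi>. \<pi> permutes ?S \<and> \<pi> 0 = j})"
    by (simp add: perm_sum_def)
  also have "\<dots> = (\<Sum>j\<in>?S. sum ?t {\<pi>. \<pi> permutes ?S \<and> \<pi> 0 = j})"
    by (rule sum.UNION_disjoint) (auto intro: finite_subset[OF _ finite_permutations[of ?S]])
  also have "\<dots> = (\<Sum>j\<in>?S. (- 1) ^ j * (v j * perm_sum n (\<lambda>i. v (insert_index j i))))"
  proof (rule sum.cong[OF refl])
    fix j assume j: "j \<in> ?S"
    have "sum ?t {\<pi>. \<pi> permutes ?S \<and> \<pi> 0 = j} =
        (\<Sum>\<sigma> | \<sigma> permutes {0..<n}. ?t (permutation_insert 0 j \<sigma>))"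
      using j by (subst permutation_fix) (auto simp: sum.reindex permutation_insert_inj_on)
    also have "\<dots> = (\<Sum>\<sigma> | \<sigma> permutes {0..<n}. (- 1) ^ j *
        (v j * (of_int (sign \<sigma>) * prod_list (map (\<lambda>i. v (insert_index j (\<sigma> i))) [0..<n]))))"
    proof (rule sum.cong[OF refl])
      fix \<sigma> assume "\<sigma> \<in> {\<sigma>. \<sigma> permutes {0..<n}}"
      then have sign: "of_int (sign (permutation_insert 0 j \<sigma>)) = (- 1) ^ j * (of_int (sign \<sigma>) :: 'a)"
        using signof_permutation_insert[of \<sigma> n 0 j, where 'a = 'a] j by simp
      have "map (\<lambda>i. v (permutation_insert 0 j \<sigma> i)) [0..<Suc n] =
          v j # map (\<lambda>i. v (insert_index j (\<sigma> i))) [0..<n]"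
        unfolding upt_conv_Cons[OF zero_less_Suc] map_Suc_upt[symmetric]
        by (simp add: permutation_insert_expand insert_index_def)
      then show "?t (permutation_insert 0 j \<sigma>) = (- 1) ^ j *
          (v j * (of_int (sign \<sigma>) * prod_list (map (\<lambda>i. v (insert_index j (\<sigma> i))) [0..<n])))"
        by (cases \<sigma> rule: sign_cases) (simp_all add: sign mult.assoc)
    qed
    finally show "sum ?t {\<pi>. \<pi> permutes ?S \<and> \<pi> 0 = j} =
        (- 1) ^ j * (v j * perm_sum n (\<lambda>i. v (insert_index j i)))"
      by (simp add: perm_sum_def sum_distrib_left)
  qed
  finally show ?thesis by (simp add: atLeast0LessThan)
qed

lemma wedge_eq_perm_sum:
  "wedge us = scalar (real_coeff (1 / fact (length us))) * perm_sum (length us) (\<lambda>i. us ! i)"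
  by (simp add: wedge_def perm_sum_def)

section \<open>Basis vectors and the number operator\<close>

definition basis_vec :: "nat set \<Rightarrow> cmod" where
  "basis_vec K L = (if L = K then 1 else 0)"

lemma vacuum_eq: "vacuum = basis_vec {}"
  by (simp add: vacuum_def basis_vec_def fun_eq_iff)

lemma del_basis_vec: "i \<in> K \<Longrightarrow> del i (basis_vec K) = (\<lambda>L. jw_sign i K * basis_vec (K - {i}) L)"
  by (auto simp: del_def basis_vec_def fun_eq_iff)

lemma del_basis_vec_notin: "i \<notin> K \<Longrightarrow> del i (basis_vec K) = (\<lambda>L. 0)"
  by (auto simp: del_def basis_vec_def fun_eq_iff)

text \<open>The contraction parts cancel since \<open>gram\<close> is symmetric while annihilators anticommute; the
  remaining sum is the number operator.\<close>

lemma sum_clifford_del: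
  "(\<Sum>i\<le>N. clifford N t i (del i f) L) = of_nat (card (L \<inter> {..N})) * f L"
proof -
  let ?S = "\<Sum>i\<le>N. contract N i (del i f) L"
  have S: "?S = (\<Sum>i\<le>N. \<Sum>j\<le>N. gram i j * del j (del i f) L)"
    by (simp only: contract_def)
  also have "\<dots> = (\<Sum>i\<le>N. \<Sum>j\<le>N. - (gram j i * del i (del j f) L))"
  proof (intro sum.cong refl)
    fix i j
    show "gram i j * del j (del i f) L = - (gram j i * del i (del j f) L)"
      by (simp only: del_del[of j i] gram_commute[of i j] mult_minus_right)
  qed
  also have "\<dots> = - (\<Sum>j\<le>N. \<Sum>i\<le>N. gram j i * del i (del j f) L)"
    unfolding sum_negf by (rule arg_cong[OF sum.swap])
  also have "\<dots> = - ?S"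
    by (simp only: S)
  finally have "?S + ?S = 0" by (simp only: eq_neg_iff_add_eq_0)
  then have S0: "?S = 0" by (rule spoly_eq_0_if_double)
  have "(\<Sum>i\<le>N. ins i (del i f) L) = (\<Sum>i\<le>N. if i \<in> L then f L else 0)"
    by (intro sum.cong refl) (auto simp: ins_def del_def jw_sign_square_mult insert_absorb)
  also have "\<dots> = (\<Sum>i\<in>{..N} \<inter> L. f L)"
    by (rule sum.inter_restrict[symmetric]) simp
  also have "\<dots> = of_nat (card (L \<inter> {..N})) * f L"
    by (simp add: Int_commute)
  finally show ?thesis
    using S0 by (simp only: clifford_def sum.distrib sum_distrib_left[symmetric]) simp
qed

section \<open>The radial algebra in finitely many vector variables\<close>

lemma half_double: "half * (2 * f) = f"
proof -
  have "half * (2 * f) = (half + half) * f" by (simp add: algebra_simps)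
  then show ?thesis by (simp add: half_add_half)
qed

lemma pvar_power: "pvar u ^ n = Poly_Mapping.single (Poly_Mapping.single u n) 1"
  by (induction n) (simp_all add: pvar_def mult_single flip: single_add)

lemma prod_list_pvar_power:
  assumes "Poly_Mapping.keys \<alpha> \<subseteq> set us" "distinct us"
  shows "prod_list (map (\<lambda>u. pvar u ^ Poly_Mapping.lookup \<alpha> u) us) = Poly_Mapping.single \<alpha> 1"
proof -
  have "prod_list (map (\<lambda>u. pvar u ^ Poly_Mapping.lookup \<alpha> u) vs) =
      Poly_Mapping.single (sum_list (map (\<lambda>u. Poly_Mapping.single u (Poly_Mapping.lookup \<alpha> u)) vs)) 1" for vs
    by (induction vs) (simp_all add: pvar_power mult_single)
  moreover have "(\<Sum>u\<in>set us. Poly_Mapping.single u (Poly_Mapping.lookup \<alpha> u)) = \<alpha>"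
  proof (rule poly_mapping_eqI)
    fix v
    have "Poly_Mapping.lookup (\<Sum>u\<in>set us. Poly_Mapping.single u (Poly_Mapping.lookup \<alpha> u)) v =
        (\<Sum>u\<in>set us. if u = v then Poly_Mapping.lookup \<alpha> v else 0)"
      by (auto simp: lookup_sum lookup_single when_def intro!: sum.cong)
    also have "\<dots> = Poly_Mapping.lookup \<alpha> v"
      using assms(1) by (auto simp: in_keys_iff)
    finally show "Poly_Mapping.lookup (\<Sum>u\<in>set us. Poly_Mapping.single u (Poly_Mapping.lookup \<alpha> u)) v =
        Poly_Mapping.lookup \<alpha> v" .
  qed
  ultimately show ?thesis
    using assms(2) by (simp add: sum_list_distinct_conv_sum_set)
qed

text \<open>The type \<open>'s\<close> consists of all variables of the radial algebra, so x and the
  y i must exhaust it: the derivative is prescribed only on what they generate.\<close>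

locale radial_frame =
  fixes x :: 's and y :: "nat \<Rightarrow> 's" and N :: nat
  assumes bij: "bij_betw y {1..N} (UNIV - {x})"
begin

definition ix :: "'s \<Rightarrow> nat" where
  "ix s = (if s = x then 0 else the_inv_into {1..N} y s)"

definition g :: "nat \<Rightarrow> ('s, coeffs) radial" where
  "g i = gen (if i = 0 then x else y i)"

lemma y_neq_x: "i \<in> {1..N} \<Longrightarrow> y i \<noteq> x"
  using bij by (auto simp: bij_betw_def)

lemma ix_le: "ix s \<le> N"
  using bij_betw_apply[OF bij_betw_the_inv_into[OF bij], of s] by (auto simp: ix_def)

lemma ix_x [simp]: "ix x = 0"
  by (simp add: ix_def)

lemma ix_y [simp]: "i \<in> {1..N} \<Longrightarrow> ix (y i) = i"
  using bij y_neq_x by (auto simp: ix_def bij_betw_def the_inv_into_f_f)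

lemma g_ix: "g (ix s) = gen s"
proof (cases "s = x")
  case False
  then have "ix s \<in> {1..N}" "y (ix s) = s"
    using bij_betw_apply[OF bij_betw_the_inv_into[OF bij], of s]
      f_the_inv_into_f_bij_betw[OF bij, of s] by (auto simp: ix_def)
  then show ?thesis by (auto simp: g_def)
qed (simp add: g_def)

abbreviation act :: "('s, coeffs) radial \<Rightarrow> cmod \<Rightarrow> cmod" where
  "act \<equiv> radial_act N ix"

definition coords :: "('s, coeffs) radial \<Rightarrow> cmod" where
  "coords F = act F vacuum"

abbreviation ev :: "spoly \<Rightarrow> ('s, coeffs) radial" where
  "ev \<equiv> eval_spoly x y N"

lemma act_g: "i \<le> N \<Longrightarrow> act (g i) f = clifford N half i f"
  by (simp add: g_def radial_act_gen)

lemma act_anticommutator: "act (anticommutator (gen s) (gen t)) f K = gram (ix s) (ix t) * f K"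
proof -
  have "act (anticommutator (gen s) (gen t)) f K =
      half * (2 * gram (ix s) (ix t)) * f K"
    by (simp add: anticommutator_def radial_act_plus radial_act_times radial_act_gen
        clifford_anticommute ix_le gram_commute distrib_left)
  then show ?thesis by (simp add: half_double)
qed

lemma act_svar_value:
  assumes "u \<in> set (scalar_vars N)"
  shows "act (svar_value x y u) f K = pvar u * f K"
proof (cases u)
  case Rvar
  have "act (svar_value x y u) f K = half * (2 * pvar Rvar) * f K"
    by (simp add: Rvar power2_eq_square gen_square radial_act_times radial_act_scalar
        act_anticommutator gram_def half_def)
  then show ?thesis by (simp add: half_double Rvar)
next
  case (Svar i)
  then show ?thesis using assms by (auto simp: set_scalar_vars act_anticommutator gram_def)
next
  case (Cvar i j)
  then show ?thesis using assms by (auto simp: set_scalar_vars act_anticommutator gram_def)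
qed

lemma act_power:
  assumes "\<And>f K. act F f K = a * f K"
  shows "act (F ^ n) f K = a ^ n * f K"
proof (induction n arbitrary: K)
  case (Suc n)
  have "act (F ^ n) f = (\<lambda>K. a ^ n * f K)" using Suc by (simp add: fun_eq_iff)
  then show ?case by (simp add: radial_act_times assms)
qed (simp add: radial_act_1)

lemma act_prod_list:
  assumes "\<And>u f K. u \<in> set us \<Longrightarrow> act (F u) f K = a u * f K"
  shows "act (prod_list (map F us)) f K = prod_list (map a us) * f K"
  using assms
proof (induction us arbitrary: K)
  case (Cons u us)
  have "act (prod_list (map F us)) f = (\<lambda>K. prod_list (map a us) * f K)"
    using Cons by (simp add: fun_eq_iff)
  then show ?case using Cons.prems by (simp add: radial_act_times)
qed (simp add: radial_act_1)

text \<open>Each indeterminate is evaluated to an element that acts as multiplication by that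
  indeterminate, so evaluation followed by the action returns the polynomial. This makes coordinates
  linear over the scalar polynomials.\<close>

lemma act_ev:
  assumes "A \<in> scalar_polys N"
  shows "act (ev A) f K = A * f K"
  using assms unfolding scalar_polys_def
proof (induction A rule: polys_in_induct)
  case (monomial_add \<alpha> c A)
  let ?p = "prod_list (map (\<lambda>u. svar_value x y u ^ Poly_Mapping.lookup \<alpha> u) (scalar_vars N))"
  have "act ?p f K = Poly_Mapping.single \<alpha> 1 * f K" for f K
    by (subst act_prod_list[where a = "\<lambda>u. pvar u ^ Poly_Mapping.lookup \<alpha> u"])
      (simp_all add: act_power act_svar_value
        prod_list_pvar_power[OF monomial_add(1) distinct_scalar_vars])
  then have "act (ev (Poly_Mapping.single \<alpha> c)) f K = pconst c * Poly_Mapping.single \<alpha> 1 * f K"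
    by (simp add: eval_spoly_single radial_act_times radial_act_scalar)
  also have "pconst c * Poly_Mapping.single \<alpha> 1 = Poly_Mapping.single \<alpha> c"
    by (simp add: pconst_def mult_single)
  finally show ?case
    by (simp add: eval_spoly_add radial_act_plus monomial_add distrib_right)
qed (simp add: radial_act_0)

lemma coords_add: "coords (F + G) K = coords F K + coords G K"
  by (simp add: coords_def radial_act_plus)

lemma coords_uminus: "coords (- F) K = - coords F K"
  by (simp add: coords_def radial_act_uminus)

lemma coords_0 [simp]: "coords 0 K = 0"
  by (simp add: coords_def radial_act_0)

lemma coords_sum: "coords (\<Sum>a\<in>A. F a) K = (\<Sum>a\<in>A. coords (F a) K)"
  by (simp add: coords_def radial_act_sum)

lemma coords_times: "coords (F * G) = act F (coords G)"
  by (simp add: coords_def radial_act_times fun_eq_iff)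

lemma coords_ev_mult: "A \<in> scalar_polys N \<Longrightarrow> coords (ev A * F) K = A * coords F K"
  by (simp add: coords_times act_ev)

lemma coords_mult_ev: "A \<in> scalar_polys N \<Longrightarrow> coords (F * ev A) K = A * coords F K"
  using centralD[OF central_eval_spoly, of F x y N A] by (simp add: coords_ev_mult)

lemma coords_scalar_mult: "coords (scalar c * F) K = pconst c * coords F K"
  by (simp add: coords_times radial_act_scalar)

lemma coords_g_mult: "i \<le> N \<Longrightarrow> coords (g i * F) = clifford N half i (coords F)"
  by (simp add: coords_times act_g)

text \<open>On the vacuum, F * g i acts as F after the left operator of g i. That operator agrees
  there with the right one, which then commutes past F.\<close>

lemma coords_mult_g: "i \<le> N \<Longrightarrow> coords (F * g i) = right_clifford N i (coords F)"
  by (simp add: coords_times) (simp add: coords_def act_g right_clifford_act ix_le right_clifford_vacuum)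

lemma coords_1: "coords 1 = basis_vec {}"
  by (simp add: coords_def radial_act_1 vacuum_eq fun_eq_iff)

subsection \<open>Coordinates of wedge products\<close>

text \<open>In the expansion along the first factor, the induction hypothesis turns the remaining
  factors into \<open>basis_vec (?K - {w j})\<close>, which up to sign is \<open>del (w j)\<close>
  applied to \<open>basis_vec ?K\<close>. The sum is then the number operator, whose value n + 1
  completes the factorial.\<close>

lemma coords_perm_sum:
  assumes "\<And>i j. i < j \<Longrightarrow> j < n \<Longrightarrow> w i < w j" "\<And>i. i < n \<Longrightarrow> w i \<le> N"
  shows "coords (perm_sum n (\<lambda>i. g (w i))) = (\<lambda>L. of_nat (fact n) * basis_vec (w ` {..<n}) L)"
  using assms
proof (induction n arbitrary: w)
  case 0
  then show ?case by (simp add: coords_1)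
next
  case (Suc n)
  let ?K = "w ` {..<Suc n}"
  have inj: "inj_on w {..<Suc n}"
    by (rule linorder_inj_onI) (use Suc.prems(1) in force)+
  have K: "?K \<subseteq> {..N}" using Suc.prems(2) by auto
  have summand: "coords (g (w j) * perm_sum n (\<lambda>i. g (w (insert_index j i)))) L =
      of_nat (fact n) * clifford N half (w j) (basis_vec (?K - {w j})) L" if j: "j < Suc n" for j L
  proof -
    have "w (insert_index j i) < w (insert_index j k)" if "i < k" "k < n" for i k
      using Suc.prems(1) that by (auto simp: insert_index_def)
    moreover have "w (insert_index j i) \<le> N" if "i < n" for i
      using Suc.prems(2) that by (auto simp: insert_index_def)
    moreover have "(\<lambda>i. w (insert_index j i)) ` {..<n} = ?K - {w j}"
    proof -
      have "(\<lambda>i. w (insert_index j i)) ` {..<n} = w ` (insert_index j ` {0..<n})"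
        by (simp add: image_image atLeast0LessThan)
      also have "\<dots> = w ` ({..<Suc n} - {j})"
        using insert_index_image[OF j] by (simp add: atLeast0LessThan)
      also have "\<dots> = ?K - {w j}"
        using inj_on_image_set_diff[OF inj, of "{..<Suc n}" "{j}"] j by auto
      finally show ?thesis .
    qed
    ultimately have "coords (perm_sum n (\<lambda>i. g (w (insert_index j i)))) =
        (\<lambda>L. of_nat (fact n) * basis_vec (?K - {w j}) L)"
      using Suc.IH[of "\<lambda>i. w (insert_index j i)"] by simp
    then show ?thesis
      using Suc.prems(2) j by (simp add: coords_g_mult clifford_smult)
  qed
  \<comment> \<open>Since \<open>w\<close> is increasing, the position j counts the elements of
    \<open>?K\<close> below \<open>w j\<close>, so the sign of the expansion is the sign of the
    annihilator.\<close>
  have sign: "(- 1) ^ j = jw_sign (w j) ?K" if j: "j < Suc n" for j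
  proof -
    have less: "w i < w j \<longleftrightarrow> i < j" if "i < Suc n" for i
      using Suc.prems(1) that j by (metis linorder_neqE_nat order_less_asym order_less_irrefl)
    have "{k \<in> ?K. k < w j} = w ` {..<j}"
    proof
      show "{k \<in> ?K. k < w j} \<subseteq> w ` {..<j}"
        using less by auto
      show "w ` {..<j} \<subseteq> {k \<in> ?K. k < w j}"
        using less j by auto
    qed
    then show ?thesis
      using inj j by (simp add: jw_sign_def card_image inj_on_subset)
  qed
  have m1: "coords ((- 1) ^ j * F) L = (- 1) ^ j * coords F L" for j F L
    by (induction j) (simp_all add: coords_uminus)
  show ?case
  proof
    fix L
    have "coords (perm_sum (Suc n) (\<lambda>i. g (w i))) L =
        (\<Sum>j<Suc n. (- 1) ^ j * (of_nat (fact n) * clifford N half (w j) (basis_vec (?K - {w j})) L))"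
      unfolding perm_sum_Suc coords_sum m1 by (intro sum.cong refl) (simp add: summand)
    also have "\<dots> = (\<Sum>j<Suc n. of_nat (fact n) * clifford N half (w j) (del (w j) (basis_vec ?K)) L)"
    proof (rule sum.cong[OF refl])
      fix j assume j: "j \<in> {..<Suc n}"
      then have "clifford N half (w j) (del (w j) (basis_vec ?K)) L =
          jw_sign (w j) ?K * clifford N half (w j) (basis_vec (?K - {w j})) L"
        by (simp add: del_basis_vec clifford_smult)
      then show "(- 1) ^ j * (of_nat (fact n) * clifford N half (w j) (basis_vec (?K - {w j})) L) =
          of_nat (fact n) * clifford N half (w j) (del (w j) (basis_vec ?K)) L"
        using sign[of j] j by (simp add: ac_simps)
    qed
    also have "\<dots> = of_nat (fact n) * (\<Sum>i\<in>?K. clifford N half i (del i (basis_vec ?K)) L)"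
      unfolding sum.reindex[OF inj] by (simp only: sum_distrib_left o_def)
    \<comment> \<open>Annihilators outside \<open>?K\<close> kill \<open>basis_vec ?K\<close>, so
      the sum may run over all indices as the number operator does.\<close>
    also have "(\<Sum>i\<in>?K. clifford N half i (del i (basis_vec ?K)) L) =
        (\<Sum>i\<le>N. clifford N half i (del i (basis_vec ?K)) L)"
    proof (rule sum.mono_neutral_left)
      have "clifford N half i (\<lambda>L. 0) L = 0" for i
        using clifford_smult[of N half i 0 "\<lambda>L. 0"] by (simp add: fun_eq_iff)
      then show "\<forall>i\<in>{..N} - ?K. clifford N half i (del i (basis_vec ?K)) L = 0"
        by (simp add: del_basis_vec_notin)
    qed (use K in auto)
    also have "\<dots> = of_nat (card (L \<inter> {..N})) * basis_vec ?K L"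
      by (rule sum_clifford_del)
    also have "\<dots> = of_nat (Suc n) * basis_vec ?K L"
      using K inj by (simp add: basis_vec_def Int_absorb2 card_image)
    finally show "coords (perm_sum (Suc n) (\<lambda>i. g (w i))) L = of_nat (fact (Suc n)) * basis_vec ?K L"
      by (simp add: algebra_simps)
  qed
qed

text \<open>As 0 comes first in every sorted list, sets containing 0 give the products x \<and> y_I
  and the others give y_I.\<close>

definition e :: "nat set \<Rightarrow> ('s, coeffs) radial" where
  "e K = wedge (map g (sorted_list_of_set K))"

lemma coords_e:
  assumes "K \<subseteq> {..N}"
  shows "coords (e K) = basis_vec K"
proof -
  have fin: "finite K" using assms finite_subset by blast
  let ?l = "sorted_list_of_set K"
  have "coords (perm_sum (length ?l) (\<lambda>i. g (?l ! i))) =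
      (\<lambda>L. of_nat (fact (length ?l)) * basis_vec ((\<lambda>i. ?l ! i) ` {..<length ?l}) L)"
  proof (rule coords_perm_sum)
    show "?l ! i < ?l ! j" if "i < j" "j < length ?l" for i j
      using that strict_sorted_list_of_set[of K] by (simp add: sorted_wrt_iff_nth_less)
    show "?l ! i \<le> N" if "i < length ?l" for i
      using nth_mem[OF that] assms fin by auto
  qed
  moreover have "(\<lambda>i. ?l ! i) ` {..<length ?l} = K"
  proof -
    have "(\<lambda>i. ?l ! i) ` {..<length ?l} = set ?l"
      by (auto simp: set_conv_nth)
    then show ?thesis using fin by simp
  qed
  moreover have "perm_sum (length ?l) (\<lambda>i. map g ?l ! i) = perm_sum (length ?l) (\<lambda>i. g (?l ! i))"
  proof -
    have "map (\<lambda>i. map g ?l ! \<pi> i) [0..<length ?l] = map (\<lambda>i. g (?l ! \<pi> i)) [0..<length ?l]"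
      if "\<pi> permutes {0..<length ?l}" for \<pi>
      using permutes_in_image[OF that] by simp
    then show ?thesis
      unfolding perm_sum_def by (intro sum.cong refl arg_cong[where f = "\<lambda>us. _ * prod_list us"]) simp
  qed
  moreover have "pconst (real_coeff (1 / fact n)) * (of_nat (fact n) * f) = f" for n and f :: spoly
  proof -
    have "of_nat (fact n) = pconst (real_coeff (fact n))"
      using real_coeff_of_nat[of "fact n"] by (simp add: pconst_of_nat)
    then have "pconst (real_coeff (1 / fact n)) * of_nat (fact n) = 1"
      by (simp flip: pconst_mult real_coeff_mult)
    then show ?thesis by (simp flip: mult.assoc)
  qed
  ultimately show ?thesis
    by (simp add: e_def wedge_eq_perm_sum coords_scalar_mult fun_eq_iff)
qed

subsection \<open>Coordinates are faithful\<close>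

lemma gram_cases:
  obtains "i = 0" "j = 0" "gram i j = 2 * pvar Rvar"
  | "i = 0" "0 < j" "gram i j = pvar (Svar j)"
  | "0 < i" "j = 0" "gram i j = pvar (Svar i)"
  | "0 < i" "i \<le> j" "gram i j = pvar (Cvar i j)"
  | "0 < j" "j < i" "gram i j = pvar (Cvar j i)"
proof (cases "i = 0 \<or> j = 0")
  case True
  with that(1-3) show ?thesis by (cases "i = 0"; cases "j = 0") (simp_all add: gram_def)
next
  case False
  with that(4,5) show ?thesis by (cases "i \<le> j") (simp_all add: gram_def)
qed

lemma Rvar_in_scalar_vars: "Rvar \<in> set (scalar_vars N)"
  by (simp add: scalar_vars_def)

lemma Svar_in_scalar_vars: "0 < i \<Longrightarrow> i \<le> N \<Longrightarrow> Svar i \<in> set (scalar_vars N)"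
  by (simp add: set_scalar_vars)

lemma Cvar_in_scalar_vars: "0 < i \<Longrightarrow> i \<le> j \<Longrightarrow> j \<le> N \<Longrightarrow> Cvar i j \<in> set (scalar_vars N)"
  by (auto simp: set_scalar_vars)

lemma gram_scalar: "i \<le> N \<Longrightarrow> j \<le> N \<Longrightarrow> gram i j \<in> scalar_polys N"
  unfolding scalar_polys_def
  by (cases i j rule: gram_cases)
    (simp_all add: polys_in_mult polys_in_pvar Rvar_in_scalar_vars Svar_in_scalar_vars
      Cvar_in_scalar_vars)

lemma ev_gram:
  assumes "i \<le> N" "j \<le> N"
  shows "ev (gram i j) = anticommutator (g i) (g j)"
proof (cases i j rule: gram_cases)
  case 1
  then show ?thesis
    by (simp add: g_def eval_spoly_mult eval_spoly_pvar Rvar_in_scalar_vars anticommutator_def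
        power2_eq_square) (simp only: mult_2)
next
  case 2
  then show ?thesis using assms by (simp add: g_def eval_spoly_pvar Svar_in_scalar_vars)
next
  case 3
  then show ?thesis using assms
    by (simp add: g_def eval_spoly_pvar Svar_in_scalar_vars anticommutator_def add.commute)
next
  case 4
  then show ?thesis using assms by (simp add: g_def eval_spoly_pvar Cvar_in_scalar_vars)
next
  case 5
  then show ?thesis using assms
    by (simp add: g_def eval_spoly_pvar Cvar_in_scalar_vars anticommutator_def add.commute)
qed

lemma g_square: "g i * g i = scalar (real_coeff (1 / 2)) * anticommutator (g i) (g i)"
  unfolding g_def by (rule gen_square)

section \<open>Normal ordering of products of generators\<close>

definition ordered_prod :: "nat set \<Rightarrow> ('s, coeffs) radial" where
  "ordered_prod K = prod_list (map g (sorted_list_of_set K))"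

lemma ordered_prod_empty [simp]: "ordered_prod {} = 1"
  by (simp add: ordered_prod_def)

lemma ordered_prod_insert:
  assumes "finite K" "\<forall>k\<in>K. m < k"
  shows "ordered_prod (insert m K) = g m * ordered_prod K"
proof -
  have "m \<notin> K" using assms by auto
  moreover have "insort m (sorted_list_of_set K) = m # sorted_list_of_set K"
    using assms by (intro insort_is_Cons) (auto simp: less_imp_le)
  ultimately show ?thesis using assms(1) by (simp add: ordered_prod_def)
qed

text \<open>The set V bounds the generators that occur in the ordered products, so that a generator
  below all of V can be prefixed without reordering.\<close>

inductive_set ordered_span :: "nat set \<Rightarrow> ('s, coeffs) radial set" for V where
  zero: "0 \<in> ordered_span V"
| step: "K \<subseteq> V \<Longrightarrow> A \<in> scalar_polys N \<Longrightarrow> F \<in> ordered_span V \<Longrightarrow>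
    ev A * ordered_prod K + F \<in> ordered_span V"

lemma ordered_span_prod: "K \<subseteq> V \<Longrightarrow> A \<in> scalar_polys N \<Longrightarrow> ev A * ordered_prod K \<in> ordered_span V"
  using ordered_span.step[OF _ _ ordered_span.zero] by fastforce

lemma ordered_span_add: "F \<in> ordered_span V \<Longrightarrow> G \<in> ordered_span V \<Longrightarrow> F + G \<in> ordered_span V"
  by (induction rule: ordered_span.induct) (simp_all add: ordered_span.step add.assoc)

lemma ordered_span_ev_mult:
  assumes "F \<in> ordered_span V" "A \<in> scalar_polys N"
  shows "ev A * F \<in> ordered_span V"
  using assms(1)
proof induction
  case (step K B F)
  have "ev A * (ev B * ordered_prod K + F) = ev (A * B) * ordered_prod K + ev A * F"
    by (simp add: distrib_left eval_spoly_mult mult.assoc)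
  moreover have "A * B \<in> scalar_polys N"
    using assms(2) step(2) by (simp add: scalar_polys_def polys_in_mult)
  ultimately show ?case using step by (simp add: ordered_span.step)
qed (simp add: ordered_span.zero)

lemma ordered_span_uminus: "F \<in> ordered_span V \<Longrightarrow> - F \<in> ordered_span V"
  using ordered_span_ev_mult[of F V "pconst (- 1)"] by (simp add: scalar_polys_def scalar_uminus)

lemma ordered_span_diff: "F \<in> ordered_span V \<Longrightarrow> G \<in> ordered_span V \<Longrightarrow> F - G \<in> ordered_span V"
  using ordered_span_add[of F V "- G"] ordered_span_uminus[of G V] by simp

lemma ordered_span_mono: "F \<in> ordered_span V \<Longrightarrow> V \<subseteq> W \<Longrightarrow> F \<in> ordered_span W"
  by (induction rule: ordered_span.induct) (auto intro: ordered_span.zero ordered_span.step)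

lemma g_mult_ev: "g i * (ev A * F) = ev A * (g i * F)"
  using centralD[OF central_eval_spoly, of "g i" x y N A] by (simp flip: mult.assoc)

lemma ordered_span_g_less:
  assumes "F \<in> ordered_span V" "finite V" "\<forall>k\<in>V. m < k"
  shows "g m * F \<in> ordered_span (insert m V)"
  using assms(1)
proof induction
  case (step K A F)
  have "g m * ordered_prod K = ordered_prod (insert m K)"
    using step(1) assms(2,3) finite_subset[OF step(1)] by (intro ordered_prod_insert[symmetric]) auto
  then have "g m * (ev A * ordered_prod K + F) = ev A * ordered_prod (insert m K) + g m * F"
    by (simp add: distrib_left g_mult_ev)
  then show ?case using step by (auto intro!: ordered_span.step)
qed (simp add: ordered_span.zero)

text \<open>The new generator moves right past smaller ones at the cost of scalar anticommutators,
  becomes a scalar if it meets its equal, and stops before a larger one.\<close>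

lemma g_mult_ordered_prod:
  assumes "finite K" "K \<subseteq> {..N}" "i \<le> N"
  shows "g i * ordered_prod K \<in> ordered_span (insert i K)"
  using assms(1,2)
proof (induction K rule: finite_linorder_min_induct)
  case empty
  then show ?case using ordered_span_prod[of "{i}" "{i}" 1] ordered_prod_insert[of "{}" i]
    by (simp add: scalar_polys_def)
next
  case (insert m K)
  have prod: "ordered_prod (insert m K) = g m * ordered_prod K"
    using insert by (intro ordered_prod_insert) auto
  show ?case
  proof (cases i m rule: linorder_cases)
    case less
    then have "g i * ordered_prod (insert m K) = ordered_prod (insert i (insert m K))"
      using insert by (intro ordered_prod_insert[symmetric]) auto
    then show ?thesis
      using ordered_span_prod[of "insert i (insert m K)" "insert i (insert m K)" 1]
      by (simp add: scalar_polys_def)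
  next
    case equal
    have "g m * g m = ev (half * gram m m)"
      using insert.prems by (simp add: eval_spoly_mult ev_gram half_def g_square)
    then have "g i * ordered_prod (insert m K) = ev (half * gram m m) * ordered_prod K"
      by (simp add: equal prod flip: mult.assoc)
    then show ?thesis
      using insert.prems gram_scalar[of m m]
      by (auto intro!: ordered_span_prod simp: scalar_polys_def half_def polys_in_mult)
  next
    case greater
    have "g i * g m = ev (gram i m) + - (g m * g i)"
      using assms(3) insert.prems by (simp add: ev_gram anticommutator_def)
    then have "g i * ordered_prod (insert m K) =
        ev (gram i m) * ordered_prod K + - (g m * (g i * ordered_prod K))"
      by (simp add: prod left_diff_distrib flip: mult.assoc)
    moreover have "ev (gram i m) * ordered_prod K \<in> ordered_span (insert m (insert i K))"
      using assms(3) insert.prems by (intro ordered_span_prod gram_scalar) auto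
    \<comment> \<open>By the induction hypothesis the inner product is spanned over
      \<open>insert i K\<close>, all of whose indices exceed m, so prefixing \<open>g m\<close>
      keeps the order.\<close>
    moreover have "g m * (g i * ordered_prod K) \<in> ordered_span (insert m (insert i K))"
      using insert greater by (intro ordered_span_g_less[of _ "insert i K"]) auto
    ultimately show ?thesis
      by (simp add: ordered_span_diff insert_commute)
  qed
qed

lemma in_ordered_span: "F \<in> ordered_span {..N}"
proof (induction F rule: radial_induct)
  case (scalar c)
  show ?case
    using ordered_span_prod[of "{}" "{..N}" "pconst c"] by (simp add: scalar_polys_def)
next
  case (add F G)
  then show ?case by (rule ordered_span_add)
next
  case (gen_mult s F)
  have "g (ix s) * F \<in> ordered_span {..N}" if "F \<in> ordered_span {..N}" for F
    using that
  proof induction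
    case (step K A F)
    have "g (ix s) * ordered_prod K \<in> ordered_span {..N}"
    proof (rule ordered_span_mono)
      show "g (ix s) * ordered_prod K \<in> ordered_span (insert (ix s) K)"
        using step(1) finite_subset[OF step(1)] by (intro g_mult_ordered_prod ix_le) auto
    qed (use step(1) ix_le[of s] in auto)
    then show ?case
      using step by (simp add: distrib_left g_mult_ev ordered_span_add ordered_span_ev_mult)
  qed (simp add: ordered_span.zero)
  then show ?case using gen_mult by (simp add: g_ix)
qed

lemma ordered_span_sum:
  assumes "F \<in> ordered_span V" "finite V"
  shows "\<exists>A. (\<forall>K. A K \<in> scalar_polys N) \<and> F = (\<Sum>K\<in>Pow V. ev (A K) * ordered_prod K)"
  using assms(1)
proof induction
  case zero
  show ?case by (intro exI[of _ "\<lambda>K. 0"]) (simp add: scalar_polys_def)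
next
  case (step K B F)
  then obtain A where A: "\<And>K. A K \<in> scalar_polys N" "F = (\<Sum>K\<in>Pow V. ev (A K) * ordered_prod K)"
    by blast
  have "(\<Sum>L\<in>Pow V. ev (A L + (if L = K then B else 0)) * ordered_prod L) =
      (\<Sum>L\<in>Pow V. ev (A L) * ordered_prod L) + (\<Sum>L\<in>Pow V. if L = K then ev B * ordered_prod L else 0)"
    unfolding sum.distrib[symmetric]
    by (intro sum.cong refl) (simp add: eval_spoly_add distrib_right)
  also have "\<dots> = F + ev B * ordered_prod K"
    using step(1) assms(2) by (simp add: A(2))
  finally show ?case
    using A(1) step(2)
    by (intro exI[of _ "\<lambda>L. A L + (if L = K then B else 0)"])
      (auto simp: scalar_polys_def polys_in_add add.commute)
qed

text \<open>Creating a new minimum m carries the sign 1 and gives the leading coefficient. The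
  contraction only removes indices from subsets of K and never reaches a set containing m.\<close>

lemma coords_ordered_prod:
  assumes "finite K" "K \<subseteq> {..N}"
  shows "coords (ordered_prod K) K = 1 \<and> (\<forall>L. coords (ordered_prod K) L \<noteq> 0 \<longrightarrow> L \<subseteq> K)"
  using assms
proof (induction K rule: finite_linorder_min_induct)
  case empty
  then show ?case by (simp add: coords_1 basis_vec_def)
next
  case (insert m K)
  let ?c = "coords (ordered_prod K)"
  have IH: "?c K = 1" "\<And>L. \<not> L \<subseteq> K \<Longrightarrow> ?c L = 0" using insert by auto
  have m: "m \<notin> K" using insert by auto
  have eq: "coords (ordered_prod (insert m K)) L = ins m ?c L + half * contract N m ?c L" for L
    using insert by (simp add: ordered_prod_insert coords_g_mult clifford_def)
  have con: "contract N m ?c L = 0" if "\<not> L \<subseteq> K" for L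
  proof -
    have "?c (insert j L) = 0" for j using that by (intro IH(2)) auto
    then show ?thesis by (auto simp: contract_def del_def intro!: sum.neutral)
  qed
  have "jw_sign m (insert m K) = 1"
  proof -
    have "{k \<in> insert m K. k < m} = {}" using insert(2) by auto
    then show ?thesis by (simp only: jw_sign_def card.empty power_0)
  qed
  then have "ins m ?c (insert m K) = 1"
    using m IH(1) by (simp add: ins_def)
  moreover have "contract N m ?c (insert m K) = 0"
    using m by (intro con) auto
  ultimately have "coords (ordered_prod (insert m K)) (insert m K) = 1"
    by (simp add: eq)
  moreover have "coords (ordered_prod (insert m K)) L = 0" if "\<not> L \<subseteq> insert m K" for L
  proof -
    have "\<not> L - {m} \<subseteq> K" "\<not> L \<subseteq> K" using that by auto
    then show ?thesis using IH(2) con by (simp add: eq ins_def)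
  qed
  ultimately show ?case by blast
qed

text \<open>Take K maximal among the sets with nonzero coefficient \<open>A K\<close>. Ordered
  products have coordinates only at subsets of their own set, so at K all others contribute nothing
  and the coordinate is \<open>A K\<close> itself.\<close>

lemma coords_eq_0_imp:
  assumes "\<And>K. coords F K = 0"
  shows "F = 0"
proof -
  obtain A where A: "\<And>K. A K \<in> scalar_polys N" "F = (\<Sum>K\<in>Pow {..N}. ev (A K) * ordered_prod K)"
    using ordered_span_sum[OF in_ordered_span, of F] by auto
  define X where "X = {K \<in> Pow {..N}. A K \<noteq> 0}"
  have "X = {}"
  proof (rule ccontr)
    assume "X \<noteq> {}"
    then obtain K where K: "K \<in> X" and max: "\<And>L. L \<in> X \<Longrightarrow> K \<subseteq> L \<Longrightarrow> K = L"
      using finite_has_maximal[of X] by (auto simp: X_def)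
    have "A L * coords (ordered_prod L) K = (if L = K then A K else 0)" if L: "L \<in> Pow {..N}" for L
    proof (cases "L = K")
      case True
      then show ?thesis
        using coords_ordered_prod[of L] L finite_subset[of L "{..N}"] by auto
    next
      case False
      have "coords (ordered_prod L) K = 0 \<or> K \<subseteq> L"
        using coords_ordered_prod[of L] L finite_subset[of L "{..N}"] by auto
      moreover have "A L = 0 \<or> \<not> K \<subseteq> L"
        using max[of L] L False by (cases "A L = 0") (auto simp: X_def)
      ultimately show ?thesis using False by auto
    qed
    then have "coords F K = (\<Sum>L\<in>Pow {..N}. if L = K then A K else 0)"
      by (simp add: A coords_sum coords_ev_mult)
    then have "coords F K = A K" using K by (simp add: X_def)
    then show False using assms K by (simp add: X_def)
  qed
  then have "\<And>K. K \<in> Pow {..N} \<Longrightarrow> A K = 0" by (auto simp: X_def)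
  then show ?thesis by (simp add: A(2))
qed

lemma coords_inject: "coords F = coords G \<Longrightarrow> F = G"
  using coords_eq_0_imp[of "F - G"] coords_add[of F "- G"] by (simp add: coords_uminus)

text \<open>These conditions cut out the image of \<open>coords\<close>; every function satisfying
  them is attained by a combination of the \<open>e K\<close>.\<close>

definition admissible :: "cmod \<Rightarrow> bool" where
  "admissible f \<longleftrightarrow> (\<forall>K. f K \<in> scalar_polys N \<and> (\<not> K \<subseteq> {..N} \<longrightarrow> f K = 0))"

lemma jw_sign_scalar: "jw_sign i K \<in> polys_in V"
  by (cases "even (card {k \<in> K. k < i})") (simp_all add: jw_sign_def polys_in_uminus)

lemma admissible_coords: "admissible (coords F)"
proof (induction F rule: radial_induct)
  case (scalar c)
  have "coords (scalar c) = (\<lambda>K. pconst c * vacuum K)"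
    by (simp add: coords_def radial_act_scalar fun_eq_iff)
  then show ?case by (auto simp: admissible_def vacuum_def scalar_polys_def)
next
  case (add F G)
  then show ?case
    by (simp add: admissible_def coords_add scalar_polys_def polys_in_add)
next
  case (gen_mult s F)
  let ?f = "coords F" and ?i = "ix s"
  have f: "?f K \<in> polys_in (set (scalar_vars N))" "\<not> K \<subseteq> {..N} \<Longrightarrow> ?f K = 0" for K
    using gen_mult by (auto simp: admissible_def scalar_polys_def)
  have "ins ?i ?f K \<in> polys_in (set (scalar_vars N))" "del j ?f K \<in> polys_in (set (scalar_vars N))" for K j
    by (auto simp: ins_def del_def intro!: polys_in_mult jw_sign_scalar f)
  then have "clifford N half ?i ?f K \<in> polys_in (set (scalar_vars N))" for K
    unfolding clifford_def contract_def using gram_scalar[OF ix_le[of s]]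
    by (intro polys_in_add polys_in_mult polys_in_sum) (auto simp: half_def scalar_polys_def)
  moreover have "clifford N half ?i ?f K = 0" if "\<not> K \<subseteq> {..N}" for K
  proof -
    have 1: "?f (K - {?i}) = 0" using that ix_le[of s] by (intro f(2)) auto
    have 2: "?f (insert j K) = 0" for j using that by (intro f(2)) auto
    have "ins ?i ?f K = 0" "contract N ?i ?f K = 0"
      by (auto simp: contract_def ins_def del_def 1 2 intro!: sum.neutral)
    then show ?thesis by (simp add: clifford_def)
  qed
  ultimately show ?case
    using coords_g_mult[OF ix_le[of s], of F] by (auto simp: g_ix admissible_def scalar_polys_def)
qed

section \<open>The derivative\<close>

lemma coords_diff: "coords (F - G) K = coords F K - coords G K"
  using coords_add[of F "- G" K] by (simp add: coords_uminus)

lemma coords_sum_e: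
  assumes "admissible f"
  shows "coords (\<Sum>K\<in>Pow {..N}. e K * ev (f K)) = f"
proof
  fix L
  have adm: "f K \<in> scalar_polys N" "\<not> K \<subseteq> {..N} \<Longrightarrow> f K = 0" for K
    using assms by (auto simp: admissible_def)
  have "coords (\<Sum>K\<in>Pow {..N}. e K * ev (f K)) L = (\<Sum>K\<in>Pow {..N}. if K = L then f L else 0)"
    unfolding coords_sum by (intro sum.cong) (auto simp: coords_mult_ev adm(1) coords_e basis_vec_def)
  also have "\<dots> = f L"
    using adm(2)[of L] by simp
  finally show "coords (\<Sum>K\<in>Pow {..N}. e K * ev (f K)) L = f L" .
qed

text \<open>Together with \<open>coords_e\<close> this is the freeness of the radial algebra over
  the scalar polynomials on wedge products.\<close>

lemma coords_expansion: "F = (\<Sum>K\<in>Pow {..N}. e K * ev (coords F K))"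
  using coords_sum_e[OF admissible_coords] by (intro coords_inject) simp

lemma y_wedge_eq:
  assumes "I \<subseteq> {1..N}"
  shows "y_wedge y I = e I"
proof -
  have "finite I" using assms finite_subset by blast
  then have "map (\<lambda>i. gen (y i)) (sorted_list_of_set I) = map g (sorted_list_of_set I)"
    using assms by (intro map_cong) (auto simp: g_def)
  then show ?thesis unfolding y_wedge_def e_def by (rule arg_cong)
qed

lemma xy_wedge_eq:
  assumes "I \<subseteq> {1..N}"
  shows "xy_wedge x y I = e (insert 0 I)"
proof -
  have fin: "finite I" using assms finite_subset by blast
  have "insort 0 (sorted_list_of_set I) = 0 # sorted_list_of_set I"
    by (rule insort_is_Cons) simp
  moreover have "0 \<notin> I" using assms by auto
  moreover have "map (\<lambda>i. gen (y i)) (sorted_list_of_set I) = map g (sorted_list_of_set I)"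
    using assms fin by (intro map_cong) (auto simp: g_def)
  ultimately have "map g (sorted_list_of_set (insert 0 I)) =
      gen x # map (\<lambda>i. gen (y i)) (sorted_list_of_set I)"
    using fin by (simp add: g_def)
  then show ?thesis by (simp only: xy_wedge_def e_def)
qed

section \<open>The scalar part of the derivative\<close>

abbreviation sderiv :: "spoly \<Rightarrow> ('s, coeffs) radial" where
  "sderiv \<equiv> scalar_deriv x y N"

lemma sderiv_add: "sderiv (A + B) = sderiv A + sderiv B"
  by (simp add: scalar_deriv_def jackson_deriv_add[OF qc_neq_1] jackson_deriv_add[OF qc_sq_neq_1]
      jackson_shift_add eval_spoly_add distrib_left sum.distrib)

lemma sderiv_mult_const:
  assumes c: "\<And>P. jackson_shift P Rvar c = c" "\<And>P i. jackson_shift P (Svar i) c = c"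
  shows "sderiv (A * c) = sderiv A * ev c"
  by (simp add: scalar_deriv_def jackson_deriv_mult_const[OF qc_neq_1 c(2)]
      jackson_deriv_mult_const[OF qc_sq_neq_1 c(1)] jackson_shift_mult c(1) eval_spoly_mult
      distrib_right sum_distrib_right mult.assoc)

lemma sderiv_0 [simp]: "sderiv 0 = 0"
  using sderiv_add[of 0 0] by simp

lemma sderiv_sum: "sderiv (\<Sum>a\<in>S. f a) = (\<Sum>a\<in>S. sderiv (f a))"
  by (induction S rule: infinite_finite_induct) (simp_all add: sderiv_add)

lemma sderiv_1: "sderiv 1 = 0"
  by (simp add: scalar_deriv_def jackson_deriv_free[OF qc_sq_neq_1 polys_in_1[of "{}"]]
      jackson_deriv_free[OF qc_neq_1 polys_in_1[of "{}"]])

lemma coeff_polys_shift: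
  assumes "c \<in> coeff_polys N"
  shows "jackson_shift P Rvar c = c" "jackson_shift P (Svar i) c = c"
  using assms by (auto simp: coeff_polys_def c_vars_def intro!: jackson_shift_free)

lemma sderiv_mult_coeff: "c \<in> coeff_polys N \<Longrightarrow> sderiv (A * c) = sderiv A * ev c"
  by (rule sderiv_mult_const) (simp_all add: coeff_polys_shift)

lemma sderiv_coeff: "c \<in> coeff_polys N \<Longrightarrow> sderiv c = 0"
  using sderiv_mult_coeff[of c 1] by (simp add: sderiv_1)

text \<open>The factor 2 later cancels the half in right multiplication.\<close>

lemma sderiv_Svar:
  assumes "j \<in> {1..N}"
  shows "sderiv (pvar (Svar j)) = 2 * g j"
proof -
  have shift_1: "jackson_shift (qc ^ 2) Rvar 1 = 1"
    by (rule jackson_shift_free[of _ "{}"]) auto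
  have "pvar (Svar j) \<in> polys_in {Svar j}" by (rule polys_in_pvar) simp
  then have "jackson_deriv (qc ^ 2) Rvar (pvar (Svar j)) = 0"
    and "jackson_shift (qc ^ 2) Rvar (jackson_deriv qc (Svar i) (pvar (Svar j))) =
      (if i = j then 1 else 0)" for i
    using jackson_deriv_free[OF qc_sq_neq_1, of "pvar (Svar j)" "{Svar j}" Rvar]
      jackson_deriv_free[OF qc_neq_1, of "pvar (Svar j)" "{Svar j}" "Svar i"]
    by (auto simp: jackson_deriv_pvar[OF qc_neq_1] shift_1)
  then have "sderiv (pvar (Svar j)) =
      2 * (\<Sum>i = 1..N. gen (y i) * ev (if i = j then 1 else 0))"
    unfolding scalar_deriv_def
    by (auto intro!: arg_cong[where f = "(*) 2"] sum.cong)
  also have "(\<Sum>i = 1..N. gen (y i) * ev (if i = j then 1 else 0)) =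
      (\<Sum>i = 1..N. if i = j then gen (y i) else 0)"
    by (intro sum.cong) auto
  finally show ?thesis using assms by (simp add: g_def)
qed

section \<open>The derivative as an explicit operator\<close>

definition deriv_term :: "nat set \<Rightarrow> spoly \<Rightarrow> ('s, coeffs) radial" where
  "deriv_term K A = (if 0 \<in> K then
     (- 1) ^ card (K - {0}) * scalar (q_m_num (- int (card (K - {0})))) * e (K - {0}) * ev A
     + scalar (q_m_pow (- int (card (K - {0})))) * e K * sderiv A
   else e K * sderiv A)"

text \<open>Reading off coordinates turns the values prescribed on the \<open>e K\<close> into a
  total operator, with no well-definedness left to check.\<close>

definition deriv_op :: "('s, coeffs) radial \<Rightarrow> ('s, coeffs) radial" where
  "deriv_op F = (\<Sum>K\<in>Pow {..N}. deriv_term K (coords F K))"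

lemma deriv_term_add: "deriv_term K (A + B) = deriv_term K A + deriv_term K B"
  by (simp add: deriv_term_def eval_spoly_add sderiv_add distrib_left)

lemma deriv_term_0 [simp]: "deriv_term K 0 = 0"
  by (simp add: deriv_term_def)

lemma scalar_left_commute: "F * (scalar c * G) = scalar c * (F * G)"
  using scalar_commute[of F c] by (simp flip: mult.assoc)

lemma sderiv_pconst: "sderiv (pconst b * A) = scalar b * sderiv A"
proof -
  have "pconst b \<in> coeff_polys N" by (simp add: coeff_polys_def)
  from sderiv_mult_coeff[OF this, of A] show ?thesis
    by (simp add: mult.commute[of A] scalar_commute)
qed

lemma deriv_term_pconst: "deriv_term K (pconst b * A) = scalar b * deriv_term K A"
  by (simp add: deriv_term_def eval_spoly_mult sderiv_pconst distrib_left scalar_left_commute[of _ b])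

lemma deriv_op_basis:
  assumes "K \<subseteq> {..N}" "A \<in> scalar_polys N"
  shows "deriv_op (e K * ev A) = deriv_term K A"
proof -
  have "deriv_op (e K * ev A) = (\<Sum>L\<in>Pow {..N}. if L = K then deriv_term K A else 0)"
    unfolding deriv_op_def using assms
    by (intro sum.cong) (auto simp: coords_mult_ev coords_e basis_vec_def)
  then show ?thesis using assms(1) by simp
qed

lemma is_right_q_deriv_iff:
  "is_right_q_deriv x y N D \<longleftrightarrow>
     (\<forall>F G. D (F + G) = D F + D G) \<and> (\<forall>b F. D (scalar b * F) = scalar b * D F) \<and>
     (\<forall>K A. K \<subseteq> {..N} \<longrightarrow> A \<in> scalar_polys N \<longrightarrow> D (e K * ev A) = deriv_term K A)"
proof -
  have range: "{..N} = insert 0 {1..N}" by auto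
  have "(\<forall>K A. K \<subseteq> {..N} \<longrightarrow> A \<in> scalar_polys N \<longrightarrow> D (e K * ev A) = deriv_term K A) \<longleftrightarrow>
    (\<forall>I A. I \<subseteq> {1..N} \<longrightarrow> A \<in> scalar_polys N \<longrightarrow> D (e I * ev A) = deriv_term I A) \<and>
    (\<forall>I A. I \<subseteq> {1..N} \<longrightarrow> A \<in> scalar_polys N \<longrightarrow>
      D (e (insert 0 I) * ev A) = deriv_term (insert 0 I) A)" (is "?L \<longleftrightarrow> ?R1 \<and> ?R2")
  proof
    assume ?L
    then show "?R1 \<and> ?R2" unfolding range by blast
  next
    assume R: "?R1 \<and> ?R2"
    have "D (e K * ev A) = deriv_term K A" if K: "K \<subseteq> {..N}" and A: "A \<in> scalar_polys N" for K A
    proof (cases "0 \<in> K")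
      case True
      then have "K = insert 0 (K - {0})" "K - {0} \<subseteq> {1..N}" using K unfolding range by auto
      then show ?thesis using R A by metis
    next
      case False
      then have "K \<subseteq> {1..N}" using K unfolding range by auto
      then show ?thesis using R A by blast
    qed
    then show ?L by blast
  qed
  moreover have "deriv_term I A = y_wedge y I * sderiv A" "e I = y_wedge y I"
    "e (insert 0 I) = xy_wedge x y I"
    "deriv_term (insert 0 I) A = (- 1) ^ card I * scalar (q_m_num (- int (card I))) * y_wedge y I * ev A
      + scalar (q_m_pow (- int (card I))) * xy_wedge x y I * sderiv A" if "I \<subseteq> {1..N}" for I A
  proof -
    have "0 \<notin> I" using that by auto
    then show "deriv_term I A = y_wedge y I * sderiv A" "e I = y_wedge y I"
      "e (insert 0 I) = xy_wedge x y I"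
      "deriv_term (insert 0 I) A = (- 1) ^ card I * scalar (q_m_num (- int (card I))) * y_wedge y I * ev A
      + scalar (q_m_pow (- int (card I))) * xy_wedge x y I * sderiv A"
      using that by (simp_all add: deriv_term_def y_wedge_eq xy_wedge_eq)
  qed
  ultimately show ?thesis unfolding is_right_q_deriv_def by simp
qed

lemma deriv_op_add: "deriv_op (F + G) = deriv_op F + deriv_op G"
  by (simp add: deriv_op_def coords_add deriv_term_add sum.distrib)

text \<open>Existence holds because the coordinates of \<open>e K * ev A\<close> are concentrated at
  K; uniqueness because every element is a finite sum of such products and a candidate is
  additive.\<close>

lemma right_q_deriv_eq: "right_q_deriv x y N = deriv_op"
  unfolding right_q_deriv_def
proof (rule the_equality)
  show "is_right_q_deriv x y N deriv_op"
    unfolding is_right_q_deriv_iff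
    by (auto simp: deriv_op_add deriv_op_basis)
      (simp add: deriv_op_def coords_scalar_mult deriv_term_pconst sum_distrib_left)
next
  fix D assume D: "is_right_q_deriv x y N D"
  then have add: "D (F + G) = D F + D G" for F G
    by (simp add: is_right_q_deriv_iff)
  then have "D 0 = 0" using add[of 0 0] by simp
  then have sum: "D (\<Sum>a\<in>S. f a) = (\<Sum>a\<in>S. D (f a))" for f :: "nat set \<Rightarrow> _" and S
    by (induction S rule: infinite_finite_induct) (simp_all add: add)
  show "D = deriv_op"
  proof
    fix F
    have "D F = (\<Sum>K\<in>Pow {..N}. D (e K * ev (coords F K)))"
      by (subst coords_expansion[of F]) (rule sum)
    also have "\<dots> = deriv_op F"
      unfolding deriv_op_def using D admissible_coords[of F]
      by (intro sum.cong) (auto simp: is_right_q_deriv_iff admissible_def)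
    finally show "D F = deriv_op F" .
  qed
qed

text \<open>The number operator once more, since its formula is insensitive to the contraction
  parameter and so also holds at minus one half. Moving parity past the annihilators gives the
  sign.\<close>

lemma sum_right_clifford_del:
  "(\<Sum>j\<le>N. right_clifford N j (del j f) L) = - (of_nat (card (L \<inter> {..N})) * parity N f L)"
proof -
  have "right_clifford N j (del j f) L = - clifford N (- half) j (del j (parity N f)) L"
    if "j \<le> N" for j
  proof -
    have "parity N (del j f) = (\<lambda>K. (- 1) * del j (parity N f) K)"
      using that by (simp add: parity_del fun_eq_iff)
    then show ?thesis by (simp only: right_clifford_def clifford_smult) simp
  qed
  then show ?thesis by (simp add: sum_negf sum_clifford_del)
qed

lemma coeff_polys_subset: "coeff_polys N \<subseteq> scalar_polys N"
  unfolding coeff_polys_def scalar_polys_def by (rule polys_in_mono) (auto simp: scalar_vars_def)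

definition eigenvalue :: "nat \<Rightarrow> coeffs" where
  "eigenvalue p = q_m_num (- int p) + of_nat p"

text \<open>The wedge products are eigenvectors, with no corrections of smaller support: in degree
  zero the operator is diagonal and not merely triangular.\<close>

lemma block_op_basis:
  assumes I: "I \<subseteq> {1..N}" and t: "t \<in> coeff_polys N"
  shows "coords (block_op x y N (e I * ev t)) L = pconst (eigenvalue (card I)) * (t * basis_vec I L)"
proof -
  \<comment> \<open>\<open>\<sigma>\<close> is the sign of moving x across the factors of y_I,
    \<open>u\<close> the parity-twisted basis vector, and \<open>d j\<close> its contraction against
    index j, scaled by t.\<close>
  define \<sigma> where "\<sigma> = jw_sign (Suc N) I"
  define u where "u = parity N (basis_vec I)"
  define d where "d j K = t * del j u K" for j K
  have I': "I \<subseteq> {..N}" "0 \<notin> I" using I by auto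
  have \<sigma>: "\<sigma> = (- 1) ^ card I"
  proof -
    have "{k \<in> I. k < Suc N} = I" using I by auto
    then show ?thesis by (simp add: \<sigma>_def jw_sign_def)
  qed
  have u: "u K = \<sigma> * basis_vec I K" for K
    by (simp add: u_def parity_def \<sigma>_def basis_vec_def)
  have parity_u: "parity N u L = basis_vec I L"
    by (simp add: u parity_def basis_vec_def \<sigma>_def jw_sign_square)
  have tS: "t \<in> scalar_polys N" using t coeff_polys_subset by auto
  have u_poly: "u K \<in> polys_in V" for K V
    by (simp add: u basis_vec_def \<sigma>_def jw_sign_scalar)
  have d_coeff: "d j K \<in> coeff_polys N" for j K
    using t unfolding coeff_polys_def d_def del_def
    by (auto intro!: polys_in_mult jw_sign_scalar u_poly)
  \<comment> \<open>I avoids the index 0 of x, so contracting against 0 gives zero and no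
    contraction contains x; only the plain clause of \<open>deriv_term\<close> will contribute for
    \<open>b\<close>.\<close>
  have d_0: "d j K = 0" if "0 \<in> K \<or> j = 0" for j K
  proof -
    have "u (insert j K) = 0" using that I'(2) by (auto simp: u basis_vec_def)
    then show ?thesis by (simp add: d_def del_def)
  qed
  have d_adm: "admissible (d j)" if "j \<le> N" for j
  proof -
    have "d j K = 0" if "\<not> K \<subseteq> {..N}" for K
    proof -
      have "insert j K \<noteq> I" using that I'(1) by auto
      then show ?thesis by (simp add: d_def del_def u basis_vec_def)
    qed
    then show ?thesis using d_coeff coeff_polys_subset by (auto simp: admissible_def)
  qed
  have coords_F: "coords (e I * ev t) = (\<lambda>K. t * basis_vec I K)"
    using I' tS by (simp add: coords_mult_ev coords_e fun_eq_iff)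
  define b where "b K = (\<Sum>j = 1..N. pvar (Svar j) * (- half * d j K))" for K
  \<comment> \<open>Creation puts x in front of y_I; contraction pairs x with y_j and leaves s_j,
    which is \<open>gram 0 j\<close>.\<close>
  have Fx: "coords (e I * ev t * gen x) K = t * \<sigma> * basis_vec (insert 0 I) K + b K" for K
  proof -
    have "coords (e I * ev t * gen x) K = t * right_clifford N 0 (basis_vec I) K"
      using coords_mult_g[of 0 "e I * ev t"] by (simp add: g_def coords_F right_clifford_smult)
    also have "\<dots> = t * ins 0 u K - half * (t * contract N 0 u K)"
      by (simp add: right_clifford_def clifford_def u_def algebra_simps)
    also have "ins 0 u K = \<sigma> * basis_vec (insert 0 I) K"
      using I'(2) by (auto simp: ins_def u basis_vec_def jw_sign_def)
    also have "half * (t * contract N 0 u K) = - b K"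
    proof -
      have "t * contract N 0 u K = (\<Sum>j\<le>N. gram 0 j * d j K)"
        by (simp add: contract_def d_def sum_distrib_left ac_simps)
      also have "\<dots> = (\<Sum>j\<in>{1..N}. gram 0 j * d j K)"
        by (rule sum.mono_neutral_right) (auto simp: d_0)
      also have "\<dots> = (\<Sum>j\<in>{1..N}. pvar (Svar j) * d j K)"
        by (intro sum.cong) (auto simp: gram_def)
      finally show ?thesis
        by (simp add: b_def sum_distrib_left sum_negf ac_simps)
    qed
    finally show ?thesis by (simp add: mult.assoc)
  qed
  \<comment> \<open>Each s_j occurs linearly with coefficients free of r and s, so it differentiates
    to \<open>2 * g j\<close>, and the 2 absorbs the half.\<close>
  have term_b: "deriv_term K (b K) = - (\<Sum>j = 1..N. e K * g j * ev (d j K))" for K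
  proof (cases "0 \<in> K")
    case True
    then show ?thesis by (simp add: b_def d_0)
  next
    case False
    have "sderiv (pvar (Svar j) * (- half * d j K)) = - (g j * ev (d j K))" if "j \<in> {1..N}" for j
    proof -
      have "- half * d j K \<in> coeff_polys N"
        using d_coeff[of j K] by (simp add: coeff_polys_def half_def polys_in_mult polys_in_uminus)
      then have "sderiv (pvar (Svar j) * (- half * d j K)) = g j * (2 * ev (- half * d j K))"
        using that by (simp only: sderiv_mult_coeff sderiv_Svar) (simp add: mult_2 distrib_left distrib_right)
      also have "2 * ev (- half * d j K) = ev (2 * (- half * d j K))"
        by (simp only: eval_spoly_mult eval_spoly_2)
      also have "2 * (- half * d j K) = - (half * (2 * d j K))"
        by (simp only: ac_simps mult_minus_left mult_minus_right)
      also have "\<dots> = pconst (- 1) * d j K"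
        unfolding half_double by (simp add: pconst_uminus)
      finally show ?thesis by (simp add: eval_spoly_mult scalar_uminus)
    qed
    then have "sderiv (b K) = (\<Sum>j = 1..N. - (g j * ev (d j K)))"
      unfolding b_def sderiv_sum by (intro sum.cong) auto
    then show ?thesis using False
      by (simp add: deriv_term_def sum_negf sum_distrib_left mult.assoc)
  qed
  \<comment> \<open>The sign \<open>\<sigma>\<close> from creating x meets the sign (-1)^p of the
    derivative rule and their product is 1; the second term of the rule vanishes because
    \<open>t * \<sigma>\<close> is constant in r and s.\<close>
  have term_a: "deriv_term (insert 0 I) (t * \<sigma>) = scalar (q_m_num (- int (card I))) * e I * ev t"
  proof -
    have "\<sigma> * \<sigma> = 1" by (simp add: \<sigma>_def jw_sign_square)
    have ev_\<sigma>: "ev \<sigma> = (- 1) ^ card I"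
    proof -
      have "(- 1) ^ n = pconst ((- 1) ^ n)" for n
        by (induction n) (simp_all add: pconst_uminus)
      then have "\<sigma> = pconst ((- 1) ^ card I)"
        unfolding \<sigma> .
      moreover have "scalar ((- 1) ^ n) = (- 1) ^ n" for n
        by (induction n) (simp_all add: scalar_uminus)
      ultimately show ?thesis by simp
    qed
    have "t * \<sigma> \<in> coeff_polys N"
      using t by (simp add: coeff_polys_def \<sigma>_def polys_in_mult jw_sign_scalar)
    then have "deriv_term (insert 0 I) (t * \<sigma>) =
        ev \<sigma> * (scalar (q_m_num (- int (card I))) * e I * ev (t * \<sigma>))"
      using I'(2) by (simp add: deriv_term_def sderiv_coeff ev_\<sigma> mult.assoc)
    also have "\<dots> = scalar (q_m_num (- int (card I))) * e I * ev (t * \<sigma> * \<sigma>)"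
      unfolding centralD[OF central_eval_spoly[of x y N \<sigma>], symmetric]
      by (simp only: eval_spoly_mult mult.assoc)
    finally show ?thesis using \<open>\<sigma> * \<sigma> = 1\<close> by (simp add: mult.assoc)
  qed
  have "block_op x y N (e I * ev t) =
      (\<Sum>K\<in>Pow {..N}. deriv_term K (t * \<sigma> * basis_vec (insert 0 I) K)) + (\<Sum>K\<in>Pow {..N}. deriv_term K (b K))"
    by (simp add: block_op_def right_q_deriv_eq deriv_op_def Fx deriv_term_add sum.distrib)
  also have "(\<Sum>K\<in>Pow {..N}. deriv_term K (t * \<sigma> * basis_vec (insert 0 I) K)) =
      (\<Sum>K\<in>Pow {..N}. if K = insert 0 I then deriv_term (insert 0 I) (t * \<sigma>) else 0)"
    by (intro sum.cong) (auto simp: basis_vec_def)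
  also have "\<dots> = scalar (q_m_num (- int (card I))) * e I * ev t"
    using I' by (simp add: term_a)
  \<comment> \<open>For each j the terms assemble into the element with coordinates
    \<open>d j\<close>, multiplied by \<open>g j\<close> on the right, so that
    \<open>coords_mult_g\<close> applies.\<close>
  also have "(\<Sum>K\<in>Pow {..N}. deriv_term K (b K)) =
      - (\<Sum>j = 1..N. (\<Sum>K\<in>Pow {..N}. e K * ev (d j K)) * g j)"
  proof -
    have "e K * g j * ev (d j K) = e K * ev (d j K) * g j" for j K
      using centralD[OF central_eval_spoly, of "g j"] by (simp add: mult.assoc)
    then show ?thesis
      unfolding term_b sum_negf by (subst sum.swap) (simp add: sum_distrib_right)
  qed
  finally have "coords (block_op x y N (e I * ev t)) L =
      pconst (q_m_num (- int (card I))) * (t * basis_vec I L)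
      - (\<Sum>j = 1..N. right_clifford N j (d j) L)"
    using I' tS
    by (simp add: coords_diff coords_sum coords_mult_g coords_sum_e d_adm coords_scalar_mult
        coords_mult_ev coords_e mult.assoc)
  \<comment> \<open>Index 0 may be added because \<open>d 0\<close> vanishes; the number operator
    runs over all generators, including x.\<close>
  also have "(\<Sum>j = 1..N. right_clifford N j (d j) L) = (\<Sum>j\<le>N. right_clifford N j (d j) L)"
  proof (rule sum.mono_neutral_left)
    have "right_clifford N 0 (\<lambda>K. 0) L = 0"
      using right_clifford_smult[of N 0 0 "\<lambda>K. 0"] by (simp add: fun_eq_iff)
    moreover have "d 0 = (\<lambda>K. 0)" by (simp add: d_0 fun_eq_iff)
    moreover have "{..N} - {1..N} = {0}" by auto
    ultimately show "\<forall>j\<in>{..N} - {1..N}. right_clifford N j (d j) L = 0" by simp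
  qed auto
  also have "\<dots> = t * (\<Sum>j\<le>N. right_clifford N j (del j u) L)"
    by (simp add: d_def[abs_def] right_clifford_smult sum_distrib_left)
  also have "\<dots> = - (of_nat (card I) * (t * basis_vec I L))"
    using I'(1) by (simp add: sum_right_clifford_del parity_u basis_vec_def Int_absorb2)
  finally show ?thesis
    by (simp add: eigenvalue_def pconst_add pconst_of_nat algebra_simps)
qed

end

section \<open>Free modules of rank one\<close>

text \<open>\<open>\<psi>\<close> is an isomorphism from the ring onto the module. Stating it
  through the record fields isolates the algebra of determinants from the cosets to which it is
  applied.\<close>

locale rank_one_module =
  fixes T :: "'a::comm_ring_1 set" and R :: "'a ring"
    and M :: "('a, 'e) module" and \<psi> :: "'a \<Rightarrow> 'e"
  assumes R_eq: "R = \<lparr>carrier = T, monoid.mult = (*), one = 1, ring.zero = 0, ring.add = (+)\<rparr>"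
    and T_0: "0 \<in> T" and T_1: "1 \<in> T"
    and T_add: "s \<in> T \<Longrightarrow> t \<in> T \<Longrightarrow> s + t \<in> T"
    and T_mult: "s \<in> T \<Longrightarrow> t \<in> T \<Longrightarrow> s * t \<in> T"
    and T_uminus: "t \<in> T \<Longrightarrow> - t \<in> T"
    and carrier_M: "carrier M = \<psi> ` T"
    and inj: "inj_on \<psi> T"
    and M_zero: "\<zero>\<^bsub>M\<^esub> = \<psi> 0"
    and M_add: "s \<in> T \<Longrightarrow> t \<in> T \<Longrightarrow> \<psi> s \<oplus>\<^bsub>M\<^esub> \<psi> t = \<psi> (s + t)"
    and M_smult: "s \<in> T \<Longrightarrow> t \<in> T \<Longrightarrow> s \<odot>\<^bsub>M\<^esub> \<psi> t = \<psi> (s * t)"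
begin

lemma cring_R: "cring R"
proof (rule cringI)
  show "abelian_group R"
    by (rule abelian_groupI)
      (auto simp: R_eq T_0 T_add add.assoc add.commute intro!: bexI[of _ "- _"] T_uminus)
  show "Group.comm_monoid R"
    by (rule comm_monoidI) (auto simp: R_eq T_1 T_mult mult.assoc mult.commute)
qed (auto simp: R_eq distrib_right)

lemma abelian_group_M: "abelian_group M"
proof (rule abelian_groupI)
  fix v assume "v \<in> carrier M"
  then obtain t where t: "t \<in> T" "v = \<psi> t" by (auto simp: carrier_M)
  then have "\<psi> (- t) \<oplus>\<^bsub>M\<^esub> v = \<zero>\<^bsub>M\<^esub>"
    by (simp add: M_add M_zero T_uminus)
  then show "\<exists>w\<in>carrier M. w \<oplus>\<^bsub>M\<^esub> v = \<zero>\<^bsub>M\<^esub>"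
    using t by (auto simp: carrier_M T_uminus)
qed (auto simp: carrier_M M_add M_zero T_0 T_add ac_simps)

sublocale M: abelian_group M
  by (rule abelian_group_M)

lemma module_M: "module R M"
  by (rule moduleI[OF cring_R abelian_group_M])
    (auto simp: R_eq carrier_M M_add M_smult T_1 T_add T_mult algebra_simps)

lemma finsum_eq:
  fixes n :: nat
  assumes "\<And>i. i < n \<Longrightarrow> h i \<in> T"
  shows "(\<Sum>i<n. h i) \<in> T \<and> (\<Oplus>\<^bsub>M\<^esub>i\<in>{..<n}. \<psi> (h i)) = \<psi> (\<Sum>i<n. h i)"
  using assms
proof (induction n)
  case 0
  then show ?case by (simp add: M_zero T_0)
next
  case (Suc n)
  have "(\<Oplus>\<^bsub>M\<^esub>i\<in>{..<Suc n}. \<psi> (h i)) = \<psi> (h n) \<oplus>\<^bsub>M\<^esub> (\<Oplus>\<^bsub>M\<^esub>i\<in>{..<n}. \<psi> (h i))"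
    unfolding lessThan_Suc using Suc.prems
    by (intro M.finsum_insert) (auto simp: carrier_M)
  then show ?case
    using Suc by (simp add: M_add T_add add.commute)
qed

lemma finsum_smult_eq:
  fixes n :: nat
  assumes "\<And>i. i < n \<Longrightarrow> h i \<in> T" "\<And>i. i < n \<Longrightarrow> \<beta> i \<in> T"
    and "\<And>i. i < n \<Longrightarrow> b i = \<psi> (\<beta> i)"
  shows "(\<Oplus>\<^bsub>M\<^esub>i\<in>{..<n}. h i \<odot>\<^bsub>M\<^esub> b i) = \<psi> (\<Sum>i<n. h i * \<beta> i)"
proof -
  have "(\<Oplus>\<^bsub>M\<^esub>i\<in>{..<n}. h i \<odot>\<^bsub>M\<^esub> b i) = (\<Oplus>\<^bsub>M\<^esub>i\<in>{..<n}. \<psi> (h i * \<beta> i))"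
    using assms by (intro M.finsum_cong') (auto simp: M_smult carrier_M T_mult)
  then show ?thesis using finsum_eq[of n "\<lambda>i. h i * \<beta> i"] assms T_mult by simp
qed

lemma is_basis_one: "is_basis R M 1 (\<lambda>_. \<psi> 1)"
  unfolding is_basis_def
proof (intro conjI ballI)
  show "(\<lambda>_. \<psi> 1) ` {..<1::nat} \<subseteq> carrier M"
    by (auto simp: carrier_M T_1)
next
  fix v assume "v \<in> carrier M"
  then obtain t where t: "t \<in> T" "v = \<psi> t" by (auto simp: carrier_M)
  have sum: "(\<Oplus>\<^bsub>M\<^esub>i\<in>{..<1::nat}. c i \<odot>\<^bsub>M\<^esub> \<psi> 1) = \<psi> (c 0)" if "c 0 \<in> T" for c
    using finsum_smult_eq[of 1 c "\<lambda>_. 1" "\<lambda>_. \<psi> 1"] that T_1 by simp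
  show "\<exists>!c. c \<in> {..<1::nat} \<rightarrow>\<^sub>E carrier R \<and> v = (\<Oplus>\<^bsub>M\<^esub>i\<in>{..<1::nat}. c i \<odot>\<^bsub>M\<^esub> \<psi> 1)"
  proof (rule ex1I[of _ "\<lambda>i\<in>{..<1::nat}. t"])
    show "(\<lambda>i\<in>{..<1::nat}. t) \<in> {..<1} \<rightarrow>\<^sub>E carrier R \<and>
        v = (\<Oplus>\<^bsub>M\<^esub>i\<in>{..<1}. (\<lambda>i\<in>{..<1::nat}. t) i \<odot>\<^bsub>M\<^esub> \<psi> 1)"
      using t sum[of "\<lambda>i\<in>{..<1::nat}. t"] by (auto simp: R_eq)
  next
    fix c assume c: "c \<in> {..<1::nat} \<rightarrow>\<^sub>E carrier R \<and> v = (\<Oplus>\<^bsub>M\<^esub>i\<in>{..<1}. c i \<odot>\<^bsub>M\<^esub> \<psi> 1)"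
    then have "c 0 \<in> T" by (auto simp: R_eq)
    then have "c 0 = t" using c sum[of c] t inj by (auto dest: inj_onD)
    show "c = (\<lambda>i\<in>{..<1::nat}. t)"
      by (rule PiE_ext[of _ "{..<1}" "\<lambda>_. carrier R"])
        (use c t \<open>c 0 = t\<close> in \<open>auto simp: R_eq\<close>)
  qed
qed

lemma free_of_rank_one: "free_of_rank R M 1"
  unfolding free_of_rank_def using module_M is_basis_one by blast

text \<open>Coefficient families are restricted to \<open>{..<n}\<close> in order to fall under the
  uniqueness clause of \<open>is_basis\<close>, which concerns extensional functions.\<close>

lemma basis_unique:
  assumes "is_basis R M n b" "\<And>i. i < n \<Longrightarrow> \<beta> i \<in> T" "\<And>i. i < n \<Longrightarrow> b i = \<psi> (\<beta> i)"
    and "\<And>i. i < n \<Longrightarrow> c i \<in> T" "\<And>i. i < n \<Longrightarrow> c' i \<in> T"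
    and eq: "(\<Sum>i<n. c i * \<beta> i) = (\<Sum>i<n. c' i * \<beta> i)" and "i < n"
  shows "c i = c' i"
proof -
  let ?c = "\<lambda>i\<in>{..<n}. c i" and ?c' = "\<lambda>i\<in>{..<n}. c' i"
  let ?v = "\<psi> (\<Sum>i<n. c i * \<beta> i)"
  have sum: "(\<Sum>i<n. c i * \<beta> i) \<in> T"
    using finsum_eq[of n "\<lambda>i. c i * \<beta> i"] assms T_mult by blast
  define P where "P = (\<lambda>c. c \<in> {..<n} \<rightarrow>\<^sub>E carrier R \<and> ?v = (\<Oplus>\<^bsub>M\<^esub>i\<in>{..<n}. c i \<odot>\<^bsub>M\<^esub> b i))"
  have "P ?c" "P ?c'"
    unfolding P_def using assms finsum_smult_eq[of n ?c \<beta> b] finsum_smult_eq[of n ?c' \<beta> b]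
    by (auto simp: R_eq)
  moreover have "\<exists>!c. P c"
    unfolding P_def using assms(1) sum by (simp add: is_basis_def carrier_M)
  ultimately have "?c = ?c'" by blast
  then have "?c i = ?c' i" by (rule fun_cong)
  then show ?thesis using \<open>i < n\<close> by simp
qed

text \<open>Two elements \<open>\<beta> 0\<close>, \<open>\<beta> 1\<close> of a commutative ring satisfy \<open>\<beta> 1 * \<beta> 0 = \<beta> 0 * \<beta> 1\<close>, so they are
  linearly dependent and every basis has length one.\<close>

lemma basis_length:
  assumes basis: "is_basis R M n b"
    and \<beta>: "\<And>i. i < n \<Longrightarrow> \<beta> i \<in> T" "\<And>i. i < n \<Longrightarrow> b i = \<psi> (\<beta> i)"
  shows "n = 1"
proof (rule ccontr)
  assume "n \<noteq> 1"
  note unique = basis_unique[OF basis \<beta>]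
  let ?\<delta> = "\<lambda>k a i. if i = k then a else (0::'a)"
  have sum_\<delta>: "(\<Sum>i<n. ?\<delta> k a i * \<beta> i) = a * \<beta> k" if "k < n" for k a
  proof -
    have "(\<Sum>i<n. ?\<delta> k a i * \<beta> i) = (\<Sum>i<n. if i = k then a * \<beta> i else 0)"
      by (intro sum.cong) auto
    then show ?thesis using that by simp
  qed
  show False
  proof (cases n)
    case 0
    have "\<psi> 1 \<in> carrier M" by (simp add: carrier_M T_1)
    then have "\<psi> 1 = \<psi> 0"
      using basis 0 unfolding is_basis_def by (force simp: M_zero)
    then show False using inj T_0 T_1 by (auto dest: inj_onD)
  next
    case (Suc m)
    with \<open>n \<noteq> 1\<close> have n: "0 < n" "1 < n" by auto
    have "?\<delta> 0 (\<beta> 1) i = ?\<delta> 1 (\<beta> 0) i" if "i < n" for i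
      by (rule unique[OF _ _ _ _ _ that])
        (use n \<beta> T_0 in \<open>auto simp: sum_\<delta> mult.commute[of "\<beta> (Suc 0)" "\<beta> 0"]\<close>)
    from this[OF n(2)] have "\<beta> 0 = 0" by simp
    have "?\<delta> 0 1 i = 0" if "i < n" for i
      by (rule unique[OF _ _ _ _ _ that, of "?\<delta> 0 1" "\<lambda>_. 0"])
        (use n \<beta> T_0 T_1 \<open>\<beta> 0 = 0\<close> in \<open>auto simp: sum_\<delta>\<close>)
    from this[OF n(1)] show False by simp
  qed
qed

text \<open>Any basis is a single element \<open>\<psi> (\<beta> 0)\<close>, and its matrix entry
  has the same product with \<open>\<beta> 0\<close> as \<open>\<delta>\<close>. Linear independence
  of the basis cancels \<open>\<beta> 0\<close>, so the ring may have zero divisors.\<close>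

lemma endo_det_eq:
  assumes \<delta>: "\<delta> \<in> T" and \<phi>: "\<And>t. t \<in> T \<Longrightarrow> \<phi> (\<psi> t) = \<psi> (\<delta> * t)"
  shows "endo_det R M \<phi> = \<delta>"
  unfolding endo_det_def
proof (rule the_equality)
  let ?A = "mat 1 1 (\<lambda>_. \<delta>)"
  have A: "?A \<in> carrier_mat 1 1" by simp
  have "(\<Oplus>\<^bsub>M\<^esub>i\<in>{..<1}. ?A $$ (i, 0) \<odot>\<^bsub>M\<^esub> \<psi> 1) = \<psi> (\<Sum>i<1. ?A $$ (i, 0) * 1)"
    by (rule finsum_smult_eq) (use \<delta> T_1 in auto)
  then have "\<phi> (\<psi> 1) = (\<Oplus>\<^bsub>M\<^esub>i\<in>{..<1}. ?A $$ (i, 0) \<odot>\<^bsub>M\<^esub> \<psi> 1)"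
    using \<phi>[OF T_1] by simp
  then show "\<exists>n b A. is_basis R M n b \<and> A \<in> carrier_mat n n \<and>
      (\<forall>i<n. \<forall>j<n. A $$ (i, j) \<in> carrier R) \<and>
      (\<forall>j<n. \<phi> (b j) = (\<Oplus>\<^bsub>M\<^esub>i\<in>{..<n}. A $$ (i, j) \<odot>\<^bsub>M\<^esub> b i)) \<and> \<delta> = det A"
    using is_basis_one A det_single[OF A] \<delta>
    by (intro exI[of _ 1] exI[of _ "\<lambda>_. \<psi> 1"] exI[of _ ?A]) (auto simp: R_eq)
next
  fix d assume "\<exists>n b A. is_basis R M n b \<and> A \<in> carrier_mat n n \<and>
      (\<forall>i<n. \<forall>j<n. A $$ (i, j) \<in> carrier R) \<and>
      (\<forall>j<n. \<phi> (b j) = (\<Oplus>\<^bsub>M\<^esub>i\<in>{..<n}. A $$ (i, j) \<odot>\<^bsub>M\<^esub> b i)) \<and> d = det A"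
  then obtain n b A where basis: "is_basis R M n b" and A: "A \<in> carrier_mat n n"
    "\<forall>i<n. \<forall>j<n. A $$ (i, j) \<in> carrier R"
    and \<phi>_b: "\<forall>j<n. \<phi> (b j) = (\<Oplus>\<^bsub>M\<^esub>i\<in>{..<n}. A $$ (i, j) \<odot>\<^bsub>M\<^esub> b i)" and d: "d = det A"
    by blast
  have "\<forall>i<n. \<exists>t. t \<in> T \<and> b i = \<psi> t"
    using basis by (auto simp: is_basis_def carrier_M)
  then obtain \<beta> where \<beta>: "\<And>i. i < n \<Longrightarrow> \<beta> i \<in> T" "\<And>i. i < n \<Longrightarrow> b i = \<psi> (\<beta> i)"
    by metis
  have n: "n = 1" by (rule basis_length[OF basis \<beta>])
  have A00: "A $$ (0, 0) \<in> T" using A(2) n by (simp add: R_eq)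
  have "(\<Oplus>\<^bsub>M\<^esub>i\<in>{..<n}. A $$ (i, 0) \<odot>\<^bsub>M\<^esub> b i) = \<psi> (\<Sum>i<n. A $$ (i, 0) * \<beta> i)"
    by (rule finsum_smult_eq) (use A00 \<beta> n in auto)
  then have "\<psi> (\<delta> * \<beta> 0) = \<psi> (A $$ (0, 0) * \<beta> 0)"
    using \<phi>_b \<phi>[of "\<beta> 0"] \<beta> n by simp
  then have "\<delta> * \<beta> 0 = A $$ (0, 0) * \<beta> 0"
    using inj \<delta> A00 \<beta> n T_mult by (auto dest!: inj_onD)
  then have "\<delta> = A $$ (0, 0)"
    using basis_unique[OF basis \<beta>, of "\<lambda>_. \<delta>" "\<lambda>_. A $$ (0, 0)" 0] \<delta> A00 n by simp
  then show "d = \<delta>"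
    using d A(1) n by (simp add: det_single)
qed

end

section \<open>The exact-support quotients in degree zero\<close>

context radial_frame begin

section \<open>Submodules cut out by coordinates\<close>

lemma coeff_polys_closed:
  "0 \<in> coeff_polys N" "1 \<in> coeff_polys N" "pconst c \<in> coeff_polys N"
  "s \<in> coeff_polys N \<Longrightarrow> t \<in> coeff_polys N \<Longrightarrow> s + t \<in> coeff_polys N"
  "s \<in> coeff_polys N \<Longrightarrow> t \<in> coeff_polys N \<Longrightarrow> s * t \<in> coeff_polys N"
  "t \<in> coeff_polys N \<Longrightarrow> - t \<in> coeff_polys N"
  by (simp_all add: coeff_polys_def polys_in_add polys_in_mult polys_in_uminus)

text \<open>For X consisting of subsets of \<open>{..N}\<close>, this is the span of the
  \<open>e K\<close> with K in X over the polynomials in the c_ij; membership becomes a condition on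
  coordinates.\<close>

definition coeff_submodule :: "nat set set \<Rightarrow> ('s, coeffs) radial set" where
  "coeff_submodule X = {F. \<forall>K. coords F K \<in> coeff_polys N \<and> (K \<notin> X \<longrightarrow> coords F K = 0)}"

lemma coords_coeff_mult: "t \<in> coeff_polys N \<Longrightarrow> coords (ev t * F) K = t * coords F K"
  using coeff_polys_subset by (auto intro: coords_ev_mult)

lemma coeff_submodule_add:
  "F \<in> coeff_submodule X \<Longrightarrow> G \<in> coeff_submodule X \<Longrightarrow> F + G \<in> coeff_submodule X"
  by (simp add: coeff_submodule_def coords_add coeff_polys_closed)

lemma coeff_submodule_ev_mult:
  "t \<in> coeff_polys N \<Longrightarrow> F \<in> coeff_submodule X \<Longrightarrow> ev t * F \<in> coeff_submodule X"
  by (simp add: coeff_submodule_def coords_coeff_mult coeff_polys_closed)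

lemma coeff_submodule_uminus: "F \<in> coeff_submodule X \<Longrightarrow> - F \<in> coeff_submodule X"
  by (simp add: coeff_submodule_def coords_uminus coeff_polys_closed)

lemma coeff_submodule_sum:
  "(\<And>a. a \<in> A \<Longrightarrow> F a \<in> coeff_submodule X) \<Longrightarrow> (\<Sum>a\<in>A. F a) \<in> coeff_submodule X"
  by (induction A rule: infinite_finite_induct)
    (auto simp: coeff_submodule_add, simp_all add: coeff_submodule_def coeff_polys_closed)

lemma coeff_submodule_mono: "X \<subseteq> X' \<Longrightarrow> coeff_submodule X \<subseteq> coeff_submodule X'"
  by (auto simp: coeff_submodule_def)

lemma e_in_coeff_submodule: "K \<in> X \<Longrightarrow> K \<subseteq> {..N} \<Longrightarrow> e K \<in> coeff_submodule X"
  by (auto simp: coeff_submodule_def coords_e basis_vec_def coeff_polys_closed)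

lemma coeff_submodule_expansion:
  assumes "F \<in> coeff_submodule X" "X \<subseteq> Pow {..N}"
  shows "F = (\<Sum>K\<in>X. ev (coords F K) * e K)"
proof -
  have "F = (\<Sum>K\<in>Pow {..N}. ev (coords F K) * e K)"
    using coords_expansion[of F] by (simp add: centralD[OF central_eval_spoly])
  also have "\<dots> = (\<Sum>K\<in>X. ev (coords F K) * e K)"
    using assms by (intro sum.mono_neutral_right) (auto simp: coeff_submodule_def)
  finally show ?thesis .
qed

text \<open>The sandwich condition on S serves both filtrations: S is the set of basis monomials in
  one case and a union of smaller filtration steps in the other.\<close>

lemma coeff_span_eq:
  assumes X: "X \<subseteq> Pow {..N}" and e: "e ` X \<subseteq> S" and S: "S \<subseteq> coeff_submodule X"
  shows "coeff_span x y N S = coeff_submodule X"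
proof
  show "coeff_span x y N S \<subseteq> coeff_submodule X"
    unfolding coeff_span_def using S
    by (auto intro!: coeff_submodule_sum coeff_submodule_ev_mult)
next
  \<comment> \<open>\<open>coeff_span\<close> attaches coefficients to elements, not to indices, so
    distinct sets must give distinct wedge products.\<close>
  have inj: "inj_on e X"
  proof (rule inj_onI)
    fix K L assume "K \<in> X" "L \<in> X" "e K = e L"
    then have "K \<subseteq> {..N}" "L \<subseteq> {..N}" "coords (e K) = coords (e L)" using X by auto
    then have "basis_vec K K = basis_vec L K" by (simp only: coords_e)
    then show "K = L" by (simp add: basis_vec_def split: if_splits)
  qed
  show "coeff_submodule X \<subseteq> coeff_span x y N S"
  proof
    fix F assume F: "F \<in> coeff_submodule X"
    let ?t = "\<lambda>b. coords F (the_inv_into X e b)"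
    have "F = (\<Sum>b\<in>e ` X. ev (?t b) * b)"
      using coeff_submodule_expansion[OF F X]
      by (simp add: sum.reindex[OF inj] the_inv_into_f_f[OF inj])
    moreover have "finite (e ` X)" using X finite_subset by blast
    moreover have "?t ` e ` X \<subseteq> coeff_polys N"
      using F by (auto simp: coeff_submodule_def)
    ultimately show "F \<in> coeff_span x y N S"
      unfolding coeff_span_def using e by (intro CollectI exI[of _ "e ` X"] exI[of _ ?t] conjI)
  qed
qed

text \<open>Degree zero excludes x, r and all s_j, which leaves the y_I; their support is I
  itself.\<close>

lemma supp_filtration_0:
  assumes "J \<subseteq> {1..N}"
  shows "supp_filtration x y N 0 J = coeff_submodule (Pow J)"
proof -
  have "basis_mon x y N ` {\<mu> \<in> mon_indices N. x_degree N \<mu> = 0 \<and> x_support \<mu> \<subseteq> J} = e ` Pow J"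
    (is "?B = _")
  proof
    show "?B \<subseteq> e ` Pow J"
    proof
      fix b assume "b \<in> ?B"
      then obtain \<epsilon> I a \<beta> where b: "b = basis_mon x y N (\<epsilon>, I, a, \<beta>)"
        and \<mu>: "(\<epsilon>, I, a, \<beta>) \<in> mon_indices N" "x_degree N (\<epsilon>, I, a, \<beta>) = 0"
          "x_support (\<epsilon>, I, a, \<beta>) \<subseteq> J" by auto
      have "\<not> \<epsilon>" "a = 0" "\<And>i. i \<in> {1..N} \<Longrightarrow> \<beta> i = 0"
        using \<mu>(2) by (auto split: if_splits)
      moreover have "map (\<lambda>i. svar_value x y (Svar i) ^ \<beta> i) [1..<N+1] = map (\<lambda>i. 1) [1..<N+1]"
        using calculation(3) by (intro map_cong) auto
      moreover have "prod_list (map (\<lambda>i. 1) is) = (1 :: ('s, coeffs) radial)" for "is" :: "nat list"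
        by (induction "is") auto
      ultimately have "b = y_wedge y I" by (simp only: b basis_mon.simps) simp
      moreover have "I \<subseteq> J" using \<mu>(3) by auto
      ultimately show "b \<in> e ` Pow J" using assms y_wedge_eq[of I] by auto
    qed
  next
    have "e I \<in> ?B" if "I \<subseteq> J" for I
    proof (rule image_eqI)
      have "prod_list (map (\<lambda>i. 1) is) = (1 :: ('s, coeffs) radial)" for "is" :: "nat list"
        by (induction "is") auto
      then show "e I = basis_mon x y N (False, I, 0, \<lambda>_. 0)"
        using that assms y_wedge_eq[of I] by simp
      show "(False, I, 0, \<lambda>_. 0) \<in> {\<mu> \<in> mon_indices N. x_degree N \<mu> = 0 \<and> x_support \<mu> \<subseteq> J}"
        using that assms by (auto simp: mon_indices_def)
    qed
    then show "e ` Pow J \<subseteq> ?B" by auto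
  qed
  moreover have "coeff_span x y N (e ` Pow J) = coeff_submodule (Pow J)"
    using assms by (intro coeff_span_eq) (auto intro!: e_in_coeff_submodule)
  ultimately show ?thesis by (simp add: supp_filtration_def)
qed

lemma lower_filtration_0:
  assumes J: "J \<subseteq> {1..N}"
  shows "lower_filtration x y N 0 J = coeff_submodule {K. K \<subset> J}"
  unfolding lower_filtration_def
proof (rule coeff_span_eq)
  show "{K. K \<subset> J} \<subseteq> Pow {..N}" using J by auto
  have supp: "supp_filtration x y N 0 K = coeff_submodule (Pow K)" if "K \<subset> J" for K
    using that J by (intro supp_filtration_0) auto
  have "e K \<in> supp_filtration x y N 0 K" if "K \<subset> J" for K
    unfolding supp[OF that] using that J by (intro e_in_coeff_submodule) auto
  then show "e ` {K. K \<subset> J} \<subseteq> (\<Union>K\<in>{K. K \<subset> J}. supp_filtration x y N 0 K)" by auto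
  have "coeff_submodule (Pow K) \<subseteq> coeff_submodule {K. K \<subset> J}" if "K \<subset> J" for K
    using that by (intro coeff_submodule_mono) auto
  then show "(\<Union>K\<in>{K. K \<subset> J}. supp_filtration x y N 0 K) \<subseteq> coeff_submodule {K. K \<subset> J}"
    using supp by auto
qed

lemma block_op_sum: "block_op x y N (\<Sum>a\<in>A. F a) = (\<Sum>a\<in>A. block_op x y N (F a))"
proof (induction A rule: infinite_finite_induct)
  case (insert a A)
  then show ?case by (simp add: block_op_def right_q_deriv_eq distrib_right deriv_op_add)
qed (simp_all add: block_op_def right_q_deriv_eq deriv_op_def)

lemma coords_block_op:
  assumes F: "F \<in> coeff_submodule (Pow J)" and J: "J \<subseteq> {1..N}"
  shows "coords (block_op x y N F) L = pconst (eigenvalue (card L)) * coords F L"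
proof -
  have t: "coords F K \<in> coeff_polys N" for K using F by (simp add: coeff_submodule_def)
  have "F = (\<Sum>K\<in>Pow J. e K * ev (coords F K))"
  proof -
    have "Pow J \<subseteq> Pow {..N}" using J by auto
    then show ?thesis
      using coeff_submodule_expansion[OF F] by (simp only: centralD[OF central_eval_spoly])
  qed
  then have "block_op x y N F = (\<Sum>K\<in>Pow J. block_op x y N (e K * ev (coords F K)))"
    using block_op_sum[of "\<lambda>K. e K * ev (coords F K)" "Pow J"] by simp
  then have "coords (block_op x y N F) L =
      (\<Sum>K\<in>Pow J. coords (block_op x y N (e K * ev (coords F K))) L)"
    by (simp add: coords_sum)
  also have "\<dots> = (\<Sum>K\<in>Pow J. if K = L then pconst (eigenvalue (card L)) * coords F L else 0)"
  proof (rule sum.cong[OF refl])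
    fix K assume "K \<in> Pow J"
    then have "K \<subseteq> {1..N}" using J by auto
    then show "coords (block_op x y N (e K * ev (coords F K))) L =
        (if K = L then pconst (eigenvalue (card L)) * coords F L else 0)"
      by (simp add: block_op_basis t basis_vec_def)
  qed
  also have "\<dots> = pconst (eigenvalue (card L)) * coords F L"
    using F J finite_subset[OF J] by (auto simp: coeff_submodule_def)
  finally show ?thesis .
qed

text \<open>Cosets modulo the lower filtration are the fibres of the coordinate at J. This is the
  isomorphism from the coefficient ring onto the quotient.\<close>

definition top_coset :: "nat set \<Rightarrow> spoly \<Rightarrow> ('s, coeffs) radial set" where
  "top_coset J t = {F \<in> coeff_submodule (Pow J). coords F J = t}"

context
  fixes J :: "nat set"
  assumes J: "J \<subseteq> {1..N}"
begin

abbreviation lower :: "('s, coeffs) radial set" where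
  "lower \<equiv> coeff_submodule {K. K \<subset> J}"

lemma top_coset_add_lower:
  assumes "F \<in> top_coset J t" "z \<in> lower"
  shows "F + z \<in> top_coset J t"
proof -
  have "z \<in> coeff_submodule (Pow J)" "coords z J = 0"
    using assms(2) coeff_submodule_mono[of "{K. K \<subset> J}" "Pow J"] by (auto simp: coeff_submodule_def)
  then show ?thesis using assms(1) by (simp add: top_coset_def coeff_submodule_add coords_add)
qed

lemma top_coset_diff:
  assumes "F \<in> top_coset J t" "G \<in> top_coset J t"
  shows "G - F \<in> lower"
  unfolding coeff_submodule_def
proof (rule CollectI, rule allI)
  fix K
  have F: "coords F K \<in> coeff_polys N" "K \<notin> Pow J \<longrightarrow> coords F K = 0" "coords F J = t"
    and G: "coords G K \<in> coeff_polys N" "K \<notin> Pow J \<longrightarrow> coords G K = 0" "coords G J = t"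
    using assms by (auto simp: top_coset_def coeff_submodule_def)
  have "coords G K + - coords F K \<in> coeff_polys N"
    using F(1) G(1) by (intro coeff_polys_closed)
  moreover have "coords G K - coords F K = 0" if "\<not> K \<subset> J"
    using F G that by (cases "K = J") auto
  ultimately show "coords (G - F) K \<in> coeff_polys N \<and> (K \<notin> {K. K \<subset> J} \<longrightarrow> coords (G - F) K = 0)"
    by (simp add: coords_diff)
qed

lemma coset_lower:
  assumes "F \<in> top_coset J t"
  shows "coset lower F = top_coset J t"
proof
  show "coset lower F \<subseteq> top_coset J t"
    using assms top_coset_add_lower by (auto simp: coset_def)
  show "top_coset J t \<subseteq> coset lower F"
  proof
    fix G assume "G \<in> top_coset J t"
    then have "G - F \<in> lower" using assms by (rule top_coset_diff[rotated])
    moreover have "G = F + (G - F)" by simp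
    ultimately show "G \<in> coset lower F" unfolding coset_def by blast
  qed
qed

lemma in_top_coset: "F \<in> coeff_submodule (Pow J) \<Longrightarrow> F \<in> top_coset J (coords F J)"
  by (simp add: top_coset_def)

lemma representative:
  assumes "t \<in> coeff_polys N"
  shows "ev t * e J \<in> top_coset J t"
proof -
  have "J \<subseteq> {..N}" using J by auto
  then show ?thesis
    using assms e_in_coeff_submodule[of J "Pow J"]
    by (simp add: top_coset_def coeff_submodule_ev_mult coords_coeff_mult coords_e basis_vec_def)
qed

lemma lower_eq: "lower = top_coset J 0"
  by (auto simp: top_coset_def coeff_submodule_def)

text \<open>An element of the sum coset is split by subtracting the fixed representative
  \<open>ev s * e J\<close>.\<close>

lemma top_coset_add:
  assumes "s \<in> coeff_polys N"
  shows "{a + b | a b. a \<in> top_coset J s \<and> b \<in> top_coset J t} = top_coset J (s + t)" (is "?L = ?R")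
proof
  show "?L \<subseteq> ?R" by (auto simp: top_coset_def coeff_submodule_add coords_add)
  show "?R \<subseteq> ?L"
  proof
    fix F assume F: "F \<in> ?R"
    let ?a = "ev s * e J"
    have a: "?a \<in> top_coset J s" by (rule representative[OF assms])
    then have "F - ?a \<in> top_coset J t"
      using F coeff_submodule_add[of F _ "- ?a"] coeff_submodule_uminus[of ?a]
      by (simp add: top_coset_def coords_diff)
    then show "F \<in> ?L" using a by (intro CollectI exI[of _ ?a] exI[of _ "F - ?a"]) simp
  qed
qed

lemma top_coset_smult:
  assumes s: "s \<in> coeff_polys N" and t: "t \<in> coeff_polys N"
  shows "{ev s * a + z | a z. a \<in> top_coset J t \<and> z \<in> lower} = top_coset J (s * t)" (is "?L = ?R")
proof
  have mult: "ev s * a \<in> top_coset J (s * t)" if "a \<in> top_coset J t" for a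
    using that s by (auto simp: top_coset_def coeff_submodule_ev_mult coords_coeff_mult)
  then show "?L \<subseteq> ?R" using top_coset_add_lower by auto
  show "?R \<subseteq> ?L"
  proof
    fix F assume F: "F \<in> ?R"
    let ?a = "ev t * e J"
    have a: "?a \<in> top_coset J t" by (rule representative[OF t])
    then have "F - ev s * ?a \<in> lower" using F mult top_coset_diff by blast
    then show "F \<in> ?L" using a by (intro CollectI exI[of _ ?a] exI[of _ "F - ev s * ?a"]) simp
  qed
qed

lemma rank_one_gr_module:
  "rank_one_module (coeff_polys N) (coeff_poly_ring N) (gr_module x y N 0 J) (top_coset J)"
proof
  note defs = gr_module_def Let_def lower_filtration_0[OF J] supp_filtration_0[OF J]
  show "carrier (gr_module x y N 0 J) = top_coset J ` coeff_polys N"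
  proof -
    have "coset lower F \<in> top_coset J ` coeff_polys N" if "F \<in> coeff_submodule (Pow J)" for F
      using coset_lower[OF in_top_coset[OF that]] that by (auto simp: coeff_submodule_def)
    moreover have "top_coset J t \<in> coset lower ` coeff_submodule (Pow J)" if "t \<in> coeff_polys N" for t
      using coset_lower[OF representative[OF that]] representative[OF that]
      by (auto simp: top_coset_def[of J t])
    ultimately show ?thesis by (auto simp: defs)
  qed
  show "inj_on (top_coset J) (coeff_polys N)"
  proof (rule inj_onI)
    fix s t assume "s \<in> coeff_polys N" and eq: "top_coset J s = top_coset J t"
    then have "ev s * e J \<in> top_coset J s" by (intro representative)
    moreover from this have "ev s * e J \<in> top_coset J t" by (simp only: eq)
    ultimately show "s = t" by (simp add: top_coset_def)
  qed
  show "\<zero>\<^bsub>gr_module x y N 0 J\<^esub> = top_coset J 0"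
    by (simp add: defs lower_eq)
qed (simp_all add: coeff_poly_ring_def coeff_polys_closed gr_module_def Let_def
    lower_filtration_0[OF J] top_coset_add top_coset_smult)

text \<open>The operator multiplies the coordinate at J of every representative by the same
  eigenvalue, so all cosets in the union coincide.\<close>

lemma gr_op_top_coset:
  assumes "t \<in> coeff_polys N"
  shows "gr_op x y N 0 J (top_coset J t) = top_coset J (pconst (eigenvalue (card J)) * t)"
proof -
  have "coset lower (block_op x y N F) = top_coset J (pconst (eigenvalue (card J)) * t)"
    if F: "F \<in> top_coset J t" for F
  proof (rule coset_lower)
    have F': "F \<in> coeff_submodule (Pow J)" "coords F J = t" using F by (auto simp: top_coset_def)
    then show "block_op x y N F \<in> top_coset J (pconst (eigenvalue (card J)) * t)"
      by (simp add: top_coset_def coeff_submodule_def coords_block_op[OF F'(1) J] coeff_polys_closed)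
  qed
  \<comment> \<open>A representative is supplied because a union over an empty coset would be
    empty.\<close>
  then show ?thesis
    using representative[OF assms] by (auto simp: gr_op_def lower_filtration_0[OF J])
qed

lemma free_of_rank_gr_module: "free_of_rank (coeff_poly_ring N) (gr_module x y N 0 J) 1"
  using rank_one_gr_module by (rule rank_one_module.free_of_rank_one)

lemma block_det_0: "block_det x y N 0 J = pconst (eigenvalue (card J))"
  unfolding block_det_def using rank_one_gr_module
  by (rule rank_one_module.endo_det_eq) (simp_all add: coeff_polys_closed gr_op_top_coset)

end

end

theorem proposition6p4:
  fixes x :: 's and y :: "nat \<Rightarrow> 's" and N :: nat
  assumes "bij_betw y {1..N} (UNIV - {x})"
  shows "(\<forall>J. J \<noteq> {} \<longrightarrow> J \<subseteq> {1..N} \<longrightarrow>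
            free_of_rank (coeff_poly_ring N) (gr_module x y N 0 J) 1 \<and>
            block_det x y N 0 J = pconst (q_m_num (- int (card J)) + of_nat (card J)))
       \<and> block_det x y N 0 {} = pconst (q_m_num 0)"
proof -
  interpret radial_frame x y N by (rule radial_frame.intro) (fact assms)
  \<comment> \<open>The empty set is the case p = 0 of the same eigenvalue formula.\<close>
  show ?thesis
    using free_of_rank_gr_module block_det_0 block_det_0[of "{}"] by (simp add: eigenvalue_def)
qed

end
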